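(* Let $\mu$ be a probability measure on $S$ with marginals $\mu_t$ on $S_t$ and let $f$ be a convex normal $\mathcal B(S)$-integrand on $\mathbb R^{(1+T)d}$. Assume that $\prod_{t=0}^T\mu_t\ll\mu$, that there exists $m\in\mathcal L^1(S,\mathcal B(S),\mu)$ such that \[ f(x,s)\ge m(s)\quad\forall x\in\mathbb R^{(1+T)d}\quad\mu\text{-a.e.}, \] and that for every $s\in S$ \[ \{x\in\mathbb R^{(1+T)d}\mid f^\infty(x,s)\le0\}=N . \] Then the problem \[ \text{minimize}\quad\int_Sf(x)\,d\mu\quad\text{over }x\in\Phi \] has a solution.
   Context: $S_0,\dots,S_T$ are Polish spaces, $S=S_0\times\cdots\times S_T$, $d\ge1$. Elements of $\mathbb R^{(1+T)d}$ are written $x=(x_0,\dots,x_T)$ with $x_t\in\mathbb R^d$, and \[ N:=\Big\{x\in\mathbb R^{(1+T)d}\ \Big|\ \sum_{t=0}^Tx_t=0\Big\}. \] A convex normal $\mathcal B(S)$-integrand is a function $f:\mathbb R^{(1+T)d}\times S\to\mathbb R\cup\{\pm\infty\}$ such that $s\mapsto\{(x,\alpha)\in\mathbb R^{(1+T)d}\times\mathbb R\mid f(x,s)\le\alpha\}$ is $\mathcal B(S)$-measurable and closed convex-valued. $f^\infty(\cdot,s)$ is the recession function of $f(\cdot,s)$: $f^\infty(x,s)=\sup_{\alpha>0}\frac{f(\bar x+\alpha x,s)-f(\bar x,s)}{\alpha}$, which is independent of the choice of $\bar x\in\operatorname{dom}f(\cdot,s)=\{x\mid f(x,s)<+\infty\}$.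 $\mathcal L^0_t$ is the space of Borel measurable functions $S_t\to\mathbb R^d$, and \[ \Phi:=\Big\{x\in\prod_{t=0}^T\mathcal L^0_t\ \Big|\ x\in\operatorname{cl}\operatorname{dom}f\quad(\mu_t)_{t=0}^T\text{-a.e.}\Big\}, \] i.e. $(x_0(s_0),\dots,x_T(s_T))\in\operatorname{cl}\operatorname{dom}f(\cdot,s)$ for all $s$ in some set $\prod_{t=0}^TA_t$ with $A_t\in\mathcal B(S_t)$ and $\mu_t(A_t)=1$. $\int_Sf(x)\,d\mu$ means $\int_Sf((x_0(s_0),\dots,x_T(s_T)),s)\,d\mu(s)$.
   Formalization: The formal theorem additionally assumes that Φ is nonempty; otherwise the claim fails, e.g. for S_0=S_1={0,1}, d=1, μ uniform, m=0 and f(x,s)=0 if x_0+x_1=s_0s_1, +∞ otherwise, where all other hypotheses hold but Φ is empty. *)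

theory Defs
  imports "HOL-Probability.Probability"
begin

text \<open>
  The time indices \<open>0, \<dots>, T\<close> are the elements of an arbitrary finite type \<open>'t\<close>
  (so that \<open>CARD('t) = 1 + T\<close>) and \<open>\<real>\<^bsup>(1+T)d\<^esup>\<close> is the type \<open>real^'d^'t\<close>. The spaces
  \<open>S\<^sub>t\<close> may differ from each other: they are abstract topologies \<open>S t\<close> whose underlying sets
  are arbitrary subsets of one type \<open>'a\<close>, which is no restriction, since any finite family of sets
  embeds into its disjoint union. A point of \<open>S\<^sub>0 \<times> \<dots> \<times> S\<^sub>T\<close> is a function \<open>s :: 't \<Rightarrow> 'a\<close>.
\<close>

text \<open>Topology-level version of the type class \<open>polish_space\<close>.\<close>

definition polish_topology :: "'a topology \<Rightarrow> bool" where
  "polish_topology X \<longleftrightarrow> completely_metrizable_space X \<and> second_countable X"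

definition borel_of :: "'a topology \<Rightarrow> 'a measure" where
  "borel_of X = sigma (topspace X) {U. openin X U}"

abbreviation prod_space :: "('t::finite \<Rightarrow> 'a topology) \<Rightarrow> ('t \<Rightarrow> 'a) topology" where
  "prod_space S \<equiv> product_topology S UNIV"

definition marginal ::
    "('t::finite \<Rightarrow> 'a topology) \<Rightarrow> ('t \<Rightarrow> 'a) measure \<Rightarrow> 't \<Rightarrow> 'a measure" where
  "marginal S \<mu> t = distr \<mu> (borel_of (S t)) (\<lambda>s. s t)"

definition zero_sum :: "(real^'d^'t) set" where
  "zero_sum = {x. (\<Sum>t\<in>UNIV. x $ t) = 0}"

definition edom :: "('v \<Rightarrow> ereal) \<Rightarrow> 'v set" where
  "edom g = {x. g x < \<infinity>}"

definition epi :: "('v \<Rightarrow> ereal) \<Rightarrow> ('v \<times> real) set" where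
  "epi g = {(x, \<alpha>). g x \<le> ereal \<alpha>}"

text \<open>Measurability of a set-valued mapping: preimages of open sets are measurable.\<close>

definition measurable_set_valued ::
    "'s measure \<Rightarrow> ('s \<Rightarrow> 'w::topological_space set) \<Rightarrow> bool" where
  "measurable_set_valued M \<Gamma> \<longleftrightarrow>
     (\<forall>U. open U \<longrightarrow> {s \<in> space M. \<Gamma> s \<inter> U \<noteq> {}} \<in> sets M)"

definition convex_normal_integrand ::
    "'s measure \<Rightarrow> ('v::real_normed_vector \<Rightarrow> 's \<Rightarrow> ereal) \<Rightarrow> bool" where
  "convex_normal_integrand M f \<longleftrightarrow>
     measurable_set_valued M (\<lambda>s. epi (\<lambda>x. f x s)) \<and>
     (\<forall>s\<in>space M. closed (epi (\<lambda>x. f x s)) \<and> convex (epi (\<lambda>x. f x s)))"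

text \<open>
  For a proper closed convex \<open>g\<close> the value does not depend on the base point in \<open>edom g\<close>.
  With the conventions of \<open>ereal\<close> the value is \<open>\<infinity>\<close> everywhere if \<open>edom g\<close> is empty
  or if \<open>g = -\<infinity>\<close> at the base point, because \<open>\<infinity> - \<infinity> = \<infinity>\<close> and
  \<open>y - (-\<infinity>) = \<infinity>\<close>; a nonempty sublevel set \<open>{x. recession_fun g x \<le> 0}\<close> therefore
  includes that there is a base point at which \<open>g\<close> is finite.
\<close>

definition recession_fun :: "('v::real_vector \<Rightarrow> ereal) \<Rightarrow> 'v \<Rightarrow> ereal" where
  "recession_fun g x =
     (let x0 = (SOME x0. x0 \<in> edom g)
      in SUP \<alpha>\<in>{(0::real)<..}. (g (x0 + \<alpha> *\<^sub>R x) - g x0) / ereal \<alpha>)"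

text \<open>
  Integral of an extended real-valued function as the difference of the integrals of the positive
  and the negative part (\<open>e2ennreal\<close> maps negative values to \<open>0\<close>); for \<open>f\<close> bounded
  below by an integrable function the negative part has finite integral.
\<close>

definition ereal_integral :: "'s measure \<Rightarrow> ('s \<Rightarrow> ereal) \<Rightarrow> ereal" where
  "ereal_integral M g =
     enn2ereal (\<integral>\<^sup>+ s. e2ennreal (g s) \<partial>M) - enn2ereal (\<integral>\<^sup>+ s. e2ennreal (- g s) \<partial>M)"

definition eval_path :: "('t::finite \<Rightarrow> 'a \<Rightarrow> real^'d) \<Rightarrow> ('t \<Rightarrow> 'a) \<Rightarrow> real^'d^'t" where
  "eval_path x s = (\<chi> t. x t (s t))"

definition feasible ::
    "('t::finite \<Rightarrow> 'a topology) \<Rightarrow> ('t \<Rightarrow> 'a) measure \<Rightarrow> (real^'d^'t \<Rightarrow> ('t \<Rightarrow> 'a) \<Rightarrow> ereal)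
      \<Rightarrow> ('t \<Rightarrow> 'a \<Rightarrow> real^'d) set" where
  "feasible S \<mu> f =
     {x. (\<forall>t. x t \<in> borel_measurable (borel_of (S t))) \<and>
         (\<exists>A. (\<forall>t. A t \<in> sets (borel_of (S t)) \<and> emeasure (marginal S \<mu> t) (A t) = 1) \<and>
              (\<forall>s \<in> PiE UNIV A. eval_path x s \<in> closure (edom (\<lambda>z. f z s))))}"

definition objective ::
    "('t::finite \<Rightarrow> 'a) measure \<Rightarrow> (real^'d^'t \<Rightarrow> ('t \<Rightarrow> 'a) \<Rightarrow> ereal)
      \<Rightarrow> ('t \<Rightarrow> 'a \<Rightarrow> real^'d) \<Rightarrow> ereal" where
  "objective \<mu> f x = ereal_integral \<mu> (\<lambda>s. f (eval_path x s) s)"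

text \<open>
  The other hypotheses of the existence theorem do not imply that \<open>feasible S \<mu> f\<close> is
  nonempty: for two discrete spaces \<open>{0, 1}\<close>, the uniform \<open>\<mu>\<close>, \<open>d = 1\<close>, and
  \<open>f x s = (if x\<^sub>0 + x\<^sub>1 = s\<^sub>0 s\<^sub>1 then 0 else \<infinity>)\<close> all of them hold, but
  \<open>s\<^sub>0 s\<^sub>1\<close> is not of the form \<open>x\<^sub>0(s\<^sub>0) + x\<^sub>1(s\<^sub>1)\<close>. As a minimizer
  is an element of the feasible set, nonemptiness is therefore an explicit hypothesis. The optimal
  value may still be \<open>\<infinity>\<close>.
\<close>

end

theory Submission
  imports Defs
begin

text \<open>
  For every \<open>s\<close> the vectors of the subspace \<open>zero_sum\<close> and their negatives are directions of recession
  of \<open>f (\<cdot>, s)\<close>, so that \<open>f (x, s)\<close> only depends on the sum of the components of \<open>x\<close>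
  (\<open>zero_sum_invariant\<close>). There are no other directions of recession, so that this sum is bounded on every
  sublevel set (\<open>bounded_sum_sublevel\<close>). The solution is a limit of a minimizing sequence that
  converges almost everywhere; Fatou's lemma and the closedness of the epigraphs show that the
  limit is feasible and optimal (\<open>limit_minimizes\<close>). The convergent minimizing sequence is found in two
  rounds, each of which minimizes an auxiliary functional satisfying a parallelogram inequality
  over decreasing sets of almost-optimal paths that are closed under midpoints
  (\<open>AE_convergent_midpoint_minimizers\<close>).

  In the first round (\<open>bounded_minimizing_sequence\<close>) upper bounds \<open>v\<close> of \<open>f (x, \<cdot>) - m\<close> with almost
  minimal integral are considered, and the functional is \<open>\<integral> exp (- v) d\<mu>\<close>. The functions \<open>v\<close> of the
  resulting sequence converge in \<open>[0, \<infinity>]\<close> \<open>\<mu>\<close>-almost everywhere, and the limit is finite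
  because their integrals are bounded. By coercivity the sums \<open>x\<^sub>0 (s\<^sub>0) + \<dots> + x\<^sub>T (s\<^sub>T)\<close> stay bounded
  for \<open>\<mu>\<close>-almost every \<open>s\<close>.

  Absolute continuity turns this into boundedness for almost every \<open>s\<close> with respect to the product of the
  marginals. By Fubini's theorem there is a point \<open>p\<close> such that the sums stay bounded when a single
  coordinate of \<open>p\<close> is varied within a set of full marginal measure. After adding
  constants that sum up to zero, each component of the paths is therefore bounded
  almost everywhere (\<open>bounded_components_shift\<close>), and the objective is unchanged.

  In the second round (\<open>convergent_minimizing_sequence\<close>) the functional is a squared weighted Hilbert space
  norm on the paths that obey these pointwise bounds. It produces a sequence all of whose
  components converge almost everywhere.
\<close>

section \<open>Convex functions that are constant along the zero-sum subspace\<close>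

lemma edom_eq_fst_epi: "edom g = fst ` epi g"
proof -
  have "\<exists>a. g x \<le> ereal a" if "g x < \<infinity>" for x
    using that by (cases "g x") auto
  then show ?thesis
    by (force simp: edom_def epi_def image_iff)
qed

lemma convex_edom:
  assumes "convex (epi g)"
  shows "convex (edom g)"
  unfolding edom_eq_fst_epi by (intro convex_linear_image linear_fst assms)

lemma midpoint_in_convex: "convex C \<Longrightarrow> a \<in> C \<Longrightarrow> b \<in> C \<Longrightarrow> midpoint a b \<in> C"
  using convexD[of C a b "1/2" "1/2"] unfolding midpoint_def by (simp add: scaleR_add_right)

text \<open>A direction in which one half-line of a closed convex set runs is a direction of recession
  of the whole set: \<open>q + d\<close> is the limit of \<open>(1 - 1/k) q + (1/k) (p + k d)\<close>.\<close>

lemma closed_convex_add_recession: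
  fixes E :: "'v::real_normed_vector set"
  assumes "closed E" "convex E" and ray: "\<And>a. a > 0 \<Longrightarrow> p + a *\<^sub>R d \<in> E" and q: "q \<in> E"
  shows "q + d \<in> E"
proof -
  let ?z = "\<lambda>k. (1 - 1 / real (Suc k)) *\<^sub>R q + (1 / real (Suc k)) *\<^sub>R (p + real (Suc k) *\<^sub>R d)"
  have "?z k \<in> E" for k
    using ray[of "real (Suc k)"] q by (intro convexD[OF \<open>convex E\<close>]) auto
  moreover have "?z \<longlonglongrightarrow> q + d"
  proof -
    have "?z = (\<lambda>k. (1 - 1 / real (Suc k)) *\<^sub>R q + (1 / real (Suc k)) *\<^sub>R p + d)"
      by (auto simp: scaleR_add_right)
    moreover have "(\<lambda>k. (1 - 1 / real (Suc k)) *\<^sub>R q + (1 / real (Suc k)) *\<^sub>R p + d)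
        \<longlonglongrightarrow> (1 - 0) *\<^sub>R q + 0 *\<^sub>R p + d"
      by (intro tendsto_intros LIMSEQ_Suc[OF lim_1_over_n])
    ultimately show ?thesis by simp
  qed
  ultimately show ?thesis
    using closed_sequentially[OF \<open>closed E\<close>, of ?z] by blast
qed

lemma unbounded_closed_convex_ray:
  fixes L :: "'v::euclidean_space set"
  assumes "closed L" "convex L" "p \<in> L" "\<not> bounded L"
  obtains e where "norm e = 1" "\<And>a. a \<ge> 0 \<Longrightarrow> p + a *\<^sub>R e \<in> L"
proof -
  have "\<exists>z\<in>L. real k + norm p + 1 < norm z" for k :: nat
    using \<open>\<not> bounded L\<close> unfolding bounded_iff by (meson not_le)
  then obtain z where z: "\<And>k. z k \<in> L" and zk: "\<And>k. real k + norm p + 1 < norm (z k)"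
    by metis
  define n where "n k = norm (z k - p)" for k
  have n: "n k > real k + 1" for k
    unfolding n_def using zk[of k] norm_triangle_ineq2[of "z k" p] by linarith
  have n0: "n k > 0" for k using n[of k] by linarith
  define w where "w k = (z k - p) /\<^sub>R n k" for k
  have nw: "norm (w k) = 1" for k
    using n0[of k] by (simp add: w_def n_def)
  then have "\<forall>k. w k \<in> sphere 0 1" by simp
  moreover have "compact (sphere (0::'v) 1)" by (rule compact_sphere)
  ultimately obtain e r where e: "e \<in> sphere 0 1" and r: "strict_mono r" and lim: "(w \<circ> r) \<longlonglongrightarrow> e"
    unfolding compact_def by blast
  have "p + a *\<^sub>R e \<in> L" if "a \<ge> 0" for a
  proof -
    have "(\<lambda>k. p + a *\<^sub>R (w \<circ> r) k) \<longlonglongrightarrow> p + a *\<^sub>R e"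
      by (intro tendsto_intros lim)
    moreover have "eventually (\<lambda>k. p + a *\<^sub>R (w \<circ> r) k \<in> L) sequentially"
    proof (rule eventually_sequentiallyI)
      fix k assume "k \<ge> nat \<lceil>a\<rceil>"
      then have "a \<le> real k" by linarith
      also have "\<dots> \<le> real (r k)" using seq_suble[OF r] by simp
      finally have le: "a \<le> n (r k)" using n[of "r k"] by linarith
      have "(1 - a / n (r k)) *\<^sub>R p + (a / n (r k)) *\<^sub>R z (r k) \<in> L"
        using le n0[of "r k"] \<open>a \<ge> 0\<close>
        by (intro convexD[OF \<open>convex L\<close>] \<open>p \<in> L\<close> z) (auto simp: divide_simps)
      also have "(1 - a / n (r k)) *\<^sub>R p + (a / n (r k)) *\<^sub>R z (r k) = p + a *\<^sub>R (w \<circ> r) k"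
        by (simp add: w_def algebra_simps divide_inverse)
      finally show "p + a *\<^sub>R (w \<circ> r) k \<in> L" .
    qed
    ultimately show ?thesis
      using Lim_in_closed_set[OF \<open>closed L\<close>] by (metis trivial_limit_sequentially)
  qed
  with e that show ?thesis by simp
qed

lemma zero_sum_uminus: "d \<in> zero_sum \<Longrightarrow> - d \<in> zero_sum"
  by (simp add: zero_sum_def sum_negf)

text \<open>If the sublevel set of the recession function is nonempty, it is computed at a base point where
  the function is finite, because the difference quotients at an infinite value are infinite. The
  two implications describe the directions of recession at this base point.\<close>

lemma recession_zero_sum_base:
  fixes g :: "real^'d^'t::finite \<Rightarrow> ereal"
  assumes rec: "{x. recession_fun g x \<le> 0} = zero_sum"
  obtains x0 c where "g x0 = ereal c"
    "\<And>d a. d \<in> zero_sum \<Longrightarrow> a > 0 \<Longrightarrow> g (x0 + a *\<^sub>R d) \<le> ereal c"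
    "\<And>d. (\<And>a. a > 0 \<Longrightarrow> g (x0 + a *\<^sub>R d) \<le> ereal c) \<Longrightarrow> d \<in> zero_sum"
proof -
  define x0 where "x0 = (SOME x0. x0 \<in> edom g)"
  have R: "recession_fun g x = (SUP a\<in>{(0::real)<..}. (g (x0 + a *\<^sub>R x) - g x0) / ereal a)" for x
    unfolding recession_fun_def x0_def Let_def ..
  have iff: "d \<in> zero_sum \<longleftrightarrow> (\<forall>a>0. (g (x0 + a *\<^sub>R d) - g x0) / ereal a \<le> 0)" for d
  proof -
    have "d \<in> zero_sum \<longleftrightarrow> recession_fun g d \<le> 0" using rec by blast
    also have "\<dots> \<longleftrightarrow> (\<forall>a>0. (g (x0 + a *\<^sub>R d) - g x0) / ereal a \<le> 0)"
      unfolding R SUP_le_iff by auto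
    finally show ?thesis .
  qed
  have "0 \<in> (zero_sum :: (real^'d^'t) set)" by (simp add: zero_sum_def)
  then have "(g x0 - g x0) / ereal 1 \<le> 0"
    unfolding iff by (metis scaleR_zero_right add_0_right zero_less_one)
  then obtain c where c: "g x0 = ereal c"
    by (cases "g x0") auto
  have le_iff: "(g (x0 + a *\<^sub>R d) - g x0) / ereal a \<le> 0 \<longleftrightarrow> g (x0 + a *\<^sub>R d) \<le> ereal c"
    if "a > 0" for a d
    using that by (cases "g (x0 + a *\<^sub>R d)") (auto simp: c divide_simps)
  show ?thesis
  proof (rule that[of x0 c, OF c])
    show "g (x0 + a *\<^sub>R d) \<le> ereal c" if "d \<in> zero_sum" "a > 0" for d a
      using that iff[of d] le_iff[of a d] by blast
    show "d \<in> zero_sum" if "\<And>a. a > 0 \<Longrightarrow> g (x0 + a *\<^sub>R d) \<le> ereal c" for d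
      using that iff[of d] le_iff[of _ d] by blast
  qed
qed

lemma zero_sum_invariant:
  fixes g :: "real^'d^'t::finite \<Rightarrow> ereal"
  assumes "closed (epi g)" "convex (epi g)" and rec: "{x. recession_fun g x \<le> 0} = zero_sum"
    and "d \<in> zero_sum"
  shows "g (x + d) = g x"
proof -
  have le: "g (x + d) \<le> g x" if "d \<in> zero_sum" for x d
  proof (rule ereal_le_real)
    obtain x0 c where "g x0 = ereal c"
      and "\<And>d a. d \<in> zero_sum \<Longrightarrow> a > 0 \<Longrightarrow> g (x0 + a *\<^sub>R d) \<le> ereal c"
      by (rule recession_zero_sum_base[OF rec]) blast
    note ray = this(2)[OF \<open>d \<in> zero_sum\<close>]
    fix \<beta> assume "g x \<le> ereal \<beta>"
    have "(x, \<beta>) + (d, 0) \<in> epi g"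
    proof (rule closed_convex_add_recession[OF assms(1,2)])
      show "(x0, c) + a *\<^sub>R (d, 0) \<in> epi g" if "a > 0" for a
        using ray[OF that] by (simp add: epi_def)
      show "(x, \<beta>) \<in> epi g" using \<open>g x \<le> ereal \<beta>\<close> by (simp add: epi_def)
    qed
    then show "g (x + d) \<le> ereal \<beta>" by (simp add: epi_def)
  qed
  from le[OF assms(4), of x] le[OF zero_sum_uminus[OF assms(4)], of "x + d"] show ?thesis
    by simp
qed

text \<open>Every sublevel set is bounded modulo the zero-sum subspace. The complement of that subspace
  used here consists of the vectors that are supported in a single component.\<close>

lemma bounded_sum_sublevel:
  fixes g :: "real^'d^'t::finite \<Rightarrow> ereal"
  assumes closed: "closed (epi g)" and convex: "convex (epi g)"
    and rec: "{x. recession_fun g x \<le> 0} = zero_sum"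
  shows "bounded ((\<lambda>x. \<Sum>t\<in>UNIV. x $ t) ` {x. g x \<le> ereal b})"
proof -
  obtain x0 c where x0: "g x0 = ereal c"
    and in_zero_sum: "\<And>d. (\<And>a. a > 0 \<Longrightarrow> g (x0 + a *\<^sub>R d) \<le> ereal c) \<Longrightarrow> d \<in> zero_sum"
    using recession_zero_sum_base[OF rec] by metis
  obtain t0 :: 't where True by blast
  define single :: "real^'d \<Rightarrow> real^'d^'t" where "single u = (\<chi> t. if t = t0 then u else 0)" for u
  have sum_single: "(\<Sum>t\<in>UNIV. single u $ t) = u" for u
    by (simp add: single_def sum.delta)
  have linear: "linear single"
    by (rule linearI) (simp_all add: single_def vec_eq_iff)
  define L where "L = {u. g (single u) \<le> ereal b}"
  have L_eq: "L = (\<lambda>u. (single u, b)) -` epi g"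
    by (auto simp: L_def epi_def)
  have "closed L"
    unfolding L_eq
    by (intro continuous_closed_vimage closed continuous_intros
        linear_continuous_at linear_conv_bounded_linear[THEN iffD1, OF linear])
  moreover have "convex L"
  proof (rule convexI)
    fix u v and a a' :: real
    assume "u \<in> L" "v \<in> L" and a: "0 \<le> a" "0 \<le> a'" "a + a' = 1"
    then have "a *\<^sub>R (single u, b) + a' *\<^sub>R (single v, b) \<in> epi g"
      by (intro convexD[OF convex]) (auto simp: L_eq)
    also have "a *\<^sub>R (single u, b) + a' *\<^sub>R (single v, b) = (single (a *\<^sub>R u + a' *\<^sub>R v), b)"
      using a by (simp add: linear_add[OF linear] linear_scale[OF linear] distrib_right[symmetric])
    finally show "a *\<^sub>R u + a' *\<^sub>R v \<in> L" by (simp add: L_eq)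
  qed
  moreover have False if p: "p \<in> L" "\<not> bounded L" for p
  proof -
    obtain e where e: "norm e = 1" and ray: "\<And>a. a \<ge> 0 \<Longrightarrow> p + a *\<^sub>R e \<in> L"
      using unbounded_closed_convex_ray[OF \<open>closed L\<close> \<open>convex L\<close> p] by metis
    have "(x0, c) + (a *\<^sub>R single e, 0) \<in> epi g" if "a > 0" for a
    proof (rule closed_convex_add_recession[OF closed convex, of "(single p, b)"])
      fix a' :: real assume "a' > 0"
      with ray[of "a' * a"] \<open>a > 0\<close> show "(single p, b) + a' *\<^sub>R (a *\<^sub>R single e, 0) \<in> epi g"
        by (simp add: L_eq linear_add[OF linear] linear_scale[OF linear])
    qed (simp add: epi_def x0)
    then have "single e \<in> zero_sum" by (intro in_zero_sum) (simp add: epi_def)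
    then have "e = 0" by (simp add: zero_sum_def sum_single)
    with e show False by simp
  qed
  ultimately have "bounded L"
    by (cases "L = {}") auto
  moreover have "(\<lambda>x. \<Sum>t\<in>UNIV. x $ t) ` {x. g x \<le> ereal b} \<subseteq> L"
  proof clarify
    fix x assume "g x \<le> ereal b"
    let ?u = "\<Sum>t\<in>UNIV. x $ t"
    have "single ?u - x \<in> zero_sum"
      using sum_single[of ?u] by (simp add: zero_sum_def sum_subtractf)
    then have "g (single ?u) = g x"
      using zero_sum_invariant[OF closed convex rec, of "single ?u - x" x] by simp
    with \<open>g x \<le> ereal b\<close> show "?u \<in> L" by (simp add: L_def)
  qed
  ultimately show ?thesis by (rule bounded_subset)
qed

section \<open>Measurability of compositions with a normal integrand\<close>

text \<open>For a closed set \<open>\<Gamma>\<close>, membership of a point means that every basic open neighbourhood of the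
  point meets \<open>\<Gamma>\<close>.\<close>

lemma sets_mem_measurable_set_valued:
  fixes w :: "'s \<Rightarrow> 'w::second_countable_topology"
  assumes \<Gamma>: "measurable_set_valued M \<Gamma>" and closed: "\<And>s. s \<in> space M \<Longrightarrow> closed (\<Gamma> s)"
    and w [measurable]: "w \<in> borel_measurable M"
  shows "{s \<in> space M. w s \<in> \<Gamma> s} \<in> sets M"
proof -
  obtain \<B> :: "'w set set" where \<B>: "countable \<B>" "topological_basis \<B>"
    using ex_countable_basis by blast
  have "w s \<in> \<Gamma> s \<longleftrightarrow> (\<forall>B\<in>\<B>. w s \<notin> B \<or> \<Gamma> s \<inter> B \<noteq> {})" if s: "s \<in> space M" for s
  proof
    assume all: "\<forall>B\<in>\<B>. w s \<notin> B \<or> \<Gamma> s \<inter> B \<noteq> {}"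
    show "w s \<in> \<Gamma> s"
    proof (rule ccontr)
      assume "w s \<notin> \<Gamma> s"
      then obtain B where "B \<in> \<B>" "w s \<in> B" "B \<subseteq> - \<Gamma> s"
        using topological_basisE[OF \<B>(2), of "- \<Gamma> s" "w s"] closed[OF s] by (auto simp: open_Compl)
      with all show False by blast
    qed
  qed blast
  then have "{s \<in> space M. w s \<in> \<Gamma> s} =
      space M - (\<Union>B\<in>\<B>. (w -` B \<inter> space M) - {s \<in> space M. \<Gamma> s \<inter> B \<noteq> {}})"
    by blast
  also have "\<dots> \<in> sets M"
  proof (intro sets.Diff sets.top sets.countable_UN'' \<B>(1))
    fix B assume "B \<in> \<B>"
    then have "open B" using \<B>(2) topological_basis_open by blast
    then show "w -` B \<inter> space M \<in> sets M" by (intro measurable_sets[OF w]) simp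
    show "{s \<in> space M. \<Gamma> s \<inter> B \<noteq> {}} \<in> sets M"
      using \<Gamma> \<open>open B\<close> by (simp add: measurable_set_valued_def)
  qed
  finally show ?thesis .
qed

lemma borel_measurable_normal_integrand:
  fixes f :: "'v::euclidean_space \<Rightarrow> 's \<Rightarrow> ereal"
  assumes "convex_normal_integrand M f" and w [measurable]: "w \<in> borel_measurable M"
  shows "(\<lambda>s. f (w s) s) \<in> borel_measurable M"
proof -
  have *: "{s \<in> space M. f (w s) s \<le> ereal a} \<in> sets M" for a
  proof -
    have "{s \<in> space M. (w s, a) \<in> epi (\<lambda>x. f x s)} \<in> sets M"
      by (rule sets_mem_measurable_set_valued)
         (use assms(1) in \<open>auto simp: convex_normal_integrand_def\<close>)
    then show ?thesis by (simp add: epi_def)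
  qed
  show ?thesis
    unfolding borel_measurable_iff_Iic_ereal
  proof
    fix a :: ereal
    show "(\<lambda>s. f (w s) s) -` {..a} \<inter> space M \<in> sets M"
    proof (cases a)
      case (real r)
      with *[of r] show ?thesis by (simp add: vimage_def Int_def conj_commute)
    next
      case PInf
      then have "(\<lambda>s. f (w s) s) -` {..a} \<inter> space M = space M" by auto
      then show ?thesis by simp
    next
      case MInf
      have "(\<lambda>s. f (w s) s) -` {..a} \<inter> space M
          = (\<Inter>n::nat. {s \<in> space M. f (w s) s \<le> ereal (- real n)})"
      proof -
        have "z = -\<infinity>" if "\<forall>n::nat. z \<le> ereal (- real n)" for z
        proof (cases z)
          case (real r)
          obtain n :: nat where "- r < real n" using reals_Archimedean2 by blast
          with that[rule_format, of n] real show ?thesis by simp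
        qed (use that in auto)
        with MInf show ?thesis by auto
      qed
      also have "\<dots> \<in> sets M" using * by (intro sets.countable_INT) auto
      finally show ?thesis .
    qed
  qed
qed

section \<open>Convergence of minimizing sequences under a parallelogram inequality\<close>

text \<open>\<open>D\<close> is a lower bound for the defect of midpoint convexity of \<open>Q\<close>. The infima of \<open>Q\<close> over the decreasing sets
  \<open>C n\<close> increase to a finite limit, so almost-minimizers over late sets have small mutual defect.\<close>

lemma midpoint_minimizing_sequence:
  fixes C :: "nat \<Rightarrow> 'x set" and Q :: "'x \<Rightarrow> real" and D :: "'x \<Rightarrow> 'x \<Rightarrow> real"
  assumes ne: "\<And>n. C n \<noteq> {}" and dec: "decseq C"
    and mid: "\<And>n x y. x \<in> C n \<Longrightarrow> y \<in> C n \<Longrightarrow> mid x y \<in> C n"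
    and Q: "\<And>x. x \<in> C 0 \<Longrightarrow> 0 \<le> Q x \<and> Q x \<le> B"
    and D: "\<And>x y. x \<in> C 0 \<Longrightarrow> y \<in> C 0 \<Longrightarrow> D x y \<le> (Q x + Q y) / 2 - Q (mid x y)"
    and \<epsilon>: "\<And>n. \<epsilon> n > 0" "decseq \<epsilon>"
  obtains g where "\<And>n. g n \<in> C n" "\<And>n. D (g n) (g (Suc n)) \<le> \<epsilon> n"
proof -
  have C0: "x \<in> C 0" if "x \<in> C n" for x n
    using that decseqD[OF dec, of 0 n] by auto
  define J where "J n = Inf (Q ` C n)" for n
  have bdd: "bdd_below (Q ` C n)" for n
    using Q C0 by (intro bdd_belowI[where m = 0]) auto
  have J_le: "J n \<le> Q x" if "x \<in> C n" for x n
    unfolding J_def by (rule cInf_lower) (use that bdd in auto)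
  have J_inc: "incseq J"
    unfolding J_def incseq_def
    by (intro allI impI cInf_superset_mono bdd image_mono decseqD[OF dec]) (use ne in auto)
  have J_bdd: "J n \<le> B" for n
    using ne[of n] J_le Q C0 by (metis ex_in_conv order_trans)
  obtain j where j: "J \<longlonglongrightarrow> j" "\<And>n. J n \<le> j"
    using incseq_convergent[OF J_inc, of B] J_bdd by blast
  have "\<exists>N\<ge>n. j - \<epsilon> n / 2 < J N" for n
  proof -
    have "eventually (\<lambda>N. j - \<epsilon> n / 2 < J N) sequentially"
      using order_tendstoD(1)[OF j(1), of "j - \<epsilon> n / 2"] \<epsilon>(1)[of n] by simp
    then show ?thesis
      using eventually_happens'[OF sequentially_bot eventually_conj[OF eventually_ge_at_top[of n]]]
      by blast
  qed
  then obtain N where N: "\<And>n. N n \<ge> n" "\<And>n. j - \<epsilon> n / 2 < J (N n)"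
    by metis
  \<comment> \<open>The index set is made increasing, so that the midpoint of two consecutive
    almost-minimizers lies in the larger of the two sets.\<close>
  define K where "K n = (\<Sum>i\<le>n. N i)" for n
  have K: "N n \<le> K n" "K n \<le> K (Suc n)" for n
    unfolding K_def by (auto intro: member_le_sum)
  have JK: "j - \<epsilon> n / 2 < J (K n)" for n
    using N(2)[of n] incseqD[OF J_inc K(1)[of n]] by linarith
  have "\<exists>x\<in>C (K n). Q x < J (K n) + \<epsilon> n / 2" for n
  proof -
    have "Inf (Q ` C (K n)) < J (K n) + \<epsilon> n / 2"
      using \<epsilon>(1)[of n] by (simp add: J_def)
    then show ?thesis
      using cInf_lessD[of "Q ` C (K n)"] ne by blast
  qed
  then obtain g where g: "\<And>n. g n \<in> C (K n)" "\<And>n. Q (g n) < J (K n) + \<epsilon> n / 2"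
    by metis
  show thesis
  proof (rule that[of g])
    fix n
    show "g n \<in> C n"
      using g(1)[of n] decseqD[OF dec order_trans[OF N(1) K(1)]] by blast
    have in_n: "g (Suc n) \<in> C (K n)"
      using g(1)[of "Suc n"] decseqD[OF dec K(2)] by blast
    have "D (g n) (g (Suc n)) \<le> (Q (g n) + Q (g (Suc n))) / 2 - Q (mid (g n) (g (Suc n)))"
      using D C0 g(1) by blast
    moreover have "J (K n) \<le> Q (mid (g n) (g (Suc n)))"
      by (intro J_le mid g in_n)
    ultimately show "D (g n) (g (Suc n)) \<le> \<epsilon> n"
      using g(2)[of n] g(2)[of "Suc n"] j(2)[of "K n"] j(2)[of "K (Suc n)"] JK[of n]
        decseqD[OF \<epsilon>(2), of n "Suc n"] by simp argo
  qed
qed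

lemma AE_convergent_if_square_increments:
  fixes a :: "nat \<Rightarrow> 'a \<Rightarrow> 'b::{banach, second_countable_topology}"
  assumes [measurable]: "\<And>k. a k \<in> borel_measurable M"
    and bound: "\<And>k. (\<integral>\<^sup>+ s. ennreal ((norm (a (Suc k) s - a k s))\<^sup>2) \<partial>M) \<le> ennreal ((1/4) ^ k)"
  shows "AE s in M. convergent (\<lambda>k. a k s)"
proof -
  let ?d = "\<lambda>k s. norm (a (Suc k) s - a k s)"
  have "(\<integral>\<^sup>+ s. (\<Sum>k. ennreal (2 ^ k * (?d k s)\<^sup>2)) \<partial>M)
      = (\<Sum>k. \<integral>\<^sup>+ s. ennreal (2 ^ k * (?d k s)\<^sup>2) \<partial>M)"
    by (rule nn_integral_suminf) measurable
  also have "\<dots> = (\<Sum>k. ennreal (2 ^ k) * \<integral>\<^sup>+ s. ennreal ((?d k s)\<^sup>2) \<partial>M)"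
    by (simp add: ennreal_mult nn_integral_cmult)
  also have "\<dots> \<le> (\<Sum>k. ennreal ((1/2) ^ k))"
  proof (intro suminf_le summableI)
    fix k
    have "ennreal (2 ^ k) * (\<integral>\<^sup>+ s. ennreal ((?d k s)\<^sup>2) \<partial>M) \<le> ennreal (2 ^ k) * ennreal ((1/4) ^ k)"
      by (intro mult_left_mono bound) simp
    also have "\<dots> = ennreal ((1/2) ^ k)"
      by (simp flip: ennreal_mult power_mult_distrib)
    finally show "ennreal (2 ^ k) * (\<integral>\<^sup>+ s. ennreal ((?d k s)\<^sup>2) \<partial>M) \<le> ennreal ((1/2) ^ k)" .
  qed
  also have "\<dots> = ennreal (\<Sum>k. (1/2) ^ k)"
    by (rule suminf_ennreal_eq[OF _ summable_sums]) (auto intro: summable_geometric)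
  finally have "(\<integral>\<^sup>+ s. (\<Sum>k. ennreal (2 ^ k * (?d k s)\<^sup>2)) \<partial>M) \<noteq> \<infinity>"
    by (metis ennreal_neq_top neq_top_trans infinity_ennreal_def)
  then have "AE s in M. (\<Sum>k. ennreal (2 ^ k * (?d k s)\<^sup>2)) \<noteq> \<infinity>"
    by (intro nn_integral_noteq_infinite) measurable
  then show ?thesis
  proof eventually_elim
    case (elim s)
    then have sq: "summable (\<lambda>k. 2 ^ k * (?d k s)\<^sup>2)"
      by (intro summable_suminf_not_top) auto
    have "summable (\<lambda>k. (1/2) ^ k + 2 ^ k * (?d k s)\<^sup>2)"
      by (intro summable_add sq summable_geometric) simp
    \<comment> \<open>\<open>2 x \<le> c + x\<^sup>2 / c\<close> with \<open>c = 1 / 2^k\<close>\<close>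
    moreover have "norm (?d k s) \<le> (1/2) ^ k + 2 ^ k * (?d k s)\<^sup>2" for k
    proof -
      have "0 \<le> 2 ^ k * (?d k s - (1/2) ^ k)\<^sup>2" by simp
      also have "\<dots> = 2 ^ k * (?d k s)\<^sup>2 - 2 * ?d k s + (1/2) ^ k"
        by (simp add: power2_eq_square field_simps)
      finally have "2 * ?d k s \<le> (1/2) ^ k + 2 ^ k * (?d k s)\<^sup>2" by simp
      then show ?thesis using norm_ge_zero[of "a (Suc k) s - a k s"] unfolding real_norm_def abs_norm_cancel by linarith
    qed
    ultimately have "summable (\<lambda>k. ?d k s)"
      by (rule summable_comparison_test')
    then have "summable (\<lambda>k. a (Suc k) s - a k s)" by (rule summable_norm_cancel)
    then have "convergent (\<lambda>n. \<Sum>k<n. a (Suc k) s - a k s)"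
      by (simp add: summable_iff_convergent)
    then have "convergent (\<lambda>n. a n s - a 0 s)" by (simp only: sum_lessThan_telescope[of "\<lambda>k. a k s"])
    then have "convergent (\<lambda>n. (a n s - a 0 s) + a 0 s)"
      by (intro convergent_add convergent_const)
    then show ?case by simp
  qed
qed

text \<open>Almost-minimizers of \<open>\<integral> (norm (a x s))\<^sup>2\<close> over the sets \<open>C n\<close> form a sequence that is Cauchy in
  the mean square with a geometric rate. The map \<open>a\<close> need not be affine; only the parallelogram
  inequality is required of it.\<close>

lemma AE_convergent_midpoint_minimizers:
  fixes a :: "'x \<Rightarrow> 's \<Rightarrow> 'b::euclidean_space"
  assumes "finite_measure M"
    and ne: "\<And>n. C n \<noteq> {}" and dec: "decseq C"
    and mid: "\<And>n x y. x \<in> C n \<Longrightarrow> y \<in> C n \<Longrightarrow> mid x y \<in> C n"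
    and a: "\<And>x. x \<in> C 0 \<Longrightarrow> a x \<in> borel_measurable M"
    and bound: "\<And>x. x \<in> C 0 \<Longrightarrow> AE s in M. norm (a x s) \<le> B"
    and para: "\<And>x y s. x \<in> C 0 \<Longrightarrow> y \<in> C 0 \<Longrightarrow> s \<in> space M \<Longrightarrow>
      (norm (a y s - a x s))\<^sup>2 / 4 \<le> ((norm (a x s))\<^sup>2 + (norm (a y s))\<^sup>2) / 2 - (norm (a (mid x y) s))\<^sup>2"
  shows "\<exists>g. (\<forall>n. g n \<in> C n) \<and> (AE s in M. convergent (\<lambda>n. a (g n) s))"
proof -
  interpret finite_measure M by fact
  have int: "integrable M (\<lambda>s. (norm (a x s))\<^sup>2)" if "x \<in> C 0" for x
  proof (rule integrable_const_bound[of _ "B\<^sup>2"])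
    show "AE s in M. norm ((norm (a x s))\<^sup>2) \<le> B\<^sup>2"
      using bound[OF that] by eventually_elim (simp add: power_mono)
    show "(\<lambda>s. (norm (a x s))\<^sup>2) \<in> borel_measurable M"
      using a[OF that] by measurable
  qed
  have int_diff: "integrable M (\<lambda>s. (norm (a y s - a x s))\<^sup>2 / 4)" if "x \<in> C 0" "y \<in> C 0" for x y
  proof (rule Bochner_Integration.integrable_bound)
    show "integrable M (\<lambda>s. ((norm (a x s))\<^sup>2 + (norm (a y s))\<^sup>2) / 2 - (norm (a (mid x y) s))\<^sup>2)"
      using that mid by (intro Bochner_Integration.integrable_diff Bochner_Integration.integrable_add integrable_divide int)
    show "(\<lambda>s. (norm (a y s - a x s))\<^sup>2 / 4) \<in> borel_measurable M"
      using a that by measurable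
    show "AE s in M. norm ((norm (a y s - a x s))\<^sup>2 / 4)
        \<le> norm (((norm (a x s))\<^sup>2 + (norm (a y s))\<^sup>2) / 2 - (norm (a (mid x y) s))\<^sup>2)"
    proof (rule AE_I2)
      have *: "norm r \<le> norm r'" if "0 \<le> r" "r \<le> r'" for r r' :: real
        using that by simp
      fix s assume "s \<in> space M"
      then show "norm ((norm (a y s - a x s))\<^sup>2 / 4)
          \<le> norm (((norm (a x s))\<^sup>2 + (norm (a y s))\<^sup>2) / 2 - (norm (a (mid x y) s))\<^sup>2)"
        by (intro * para that) simp
    qed
  qed
  define Q where "Q x = (\<integral>s. (norm (a x s))\<^sup>2 \<partial>M)" for x
  define D where "D x y = (\<integral>s. (norm (a y s - a x s))\<^sup>2 / 4 \<partial>M)" for x y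
  obtain g where g: "\<And>n. g n \<in> C n" and gD: "\<And>n. D (g n) (g (Suc n)) \<le> (1/4) ^ n / 4"
  proof (rule midpoint_minimizing_sequence[of C mid Q "B\<^sup>2 * measure M (space M)" D "\<lambda>n. (1/4) ^ n / 4"])
    show "0 \<le> Q x \<and> Q x \<le> B\<^sup>2 * measure M (space M)" if "x \<in> C 0" for x
    proof
      show "0 \<le> Q x" by (simp add: Q_def)
      have "Q x \<le> (\<integral>s. B\<^sup>2 \<partial>M)"
        unfolding Q_def
      proof (intro integral_mono_AE int that)
        show "AE s in M. (norm (a x s))\<^sup>2 \<le> B\<^sup>2"
          using bound[OF that] by eventually_elim (simp add: power_mono)
      qed simp
      then show "Q x \<le> B\<^sup>2 * measure M (space M)" by (simp add: mult.commute)
    qed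
    show "D x y \<le> (Q x + Q y) / 2 - Q (mid x y)" if "x \<in> C 0" "y \<in> C 0" for x y
    proof -
      have "D x y \<le> (\<integral>s. ((norm (a x s))\<^sup>2 + (norm (a y s))\<^sup>2) / 2 - (norm (a (mid x y) s))\<^sup>2 \<partial>M)"
        unfolding D_def using that mid para[OF that]
        by (intro integral_mono int_diff Bochner_Integration.integrable_diff
            Bochner_Integration.integrable_add integrable_divide int)
      also have "\<dots> = (Q x + Q y) / 2 - Q (mid x y)"
        unfolding Q_def using int mid that by simp
      finally show ?thesis .
    qed
    show "decseq (\<lambda>n. (1/4) ^ n / 4 :: real)"
      by (intro decseq_SucI) simp
  qed (use ne dec mid in auto)
  have g0: "g n \<in> C 0" for n
    using g[of n] decseqD[OF dec, of 0 n] by auto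
  have "AE s in M. convergent (\<lambda>n. a (g n) s)"
  proof (rule AE_convergent_if_square_increments)
    show "a (g k) \<in> borel_measurable M" for k by (rule a[OF g0])
    fix k
    have "integrable M (\<lambda>s. 4 * ((norm (a (g (Suc k)) s - a (g k) s))\<^sup>2 / 4))"
      by (intro integrable_mult_right int_diff g0)
    then have "(\<integral>\<^sup>+ s. ennreal ((norm (a (g (Suc k)) s - a (g k) s))\<^sup>2) \<partial>M)
        = ennreal (4 * D (g k) (g (Suc k)))"
      unfolding D_def by (subst nn_integral_eq_integral) auto
    also have "\<dots> \<le> ennreal ((1/4) ^ k)"
      using gD[of k] by (intro ennreal_leI) simp
    finally show "(\<integral>\<^sup>+ s. ennreal ((norm (a (g (Suc k)) s - a (g k) s))\<^sup>2) \<partial>M) \<le> ennreal ((1/4) ^ k)" .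
  qed
  with g show ?thesis by blast
qed

section \<open>Auxiliary facts on limits inferior and integrals\<close>

text \<open>If the transform \<open>exp (- v k / 2)\<close> converges to a positive limit then \<open>v\<close> converges; if it
  converges to \<open>0\<close> then \<open>v\<close> tends to infinity, against the hypothesis on the limit inferior.\<close>

lemma bounded_above_if_exp_convergent:
  fixes v :: "nat \<Rightarrow> real"
  assumes conv: "convergent (\<lambda>k. exp (- v k / 2))"
    and lim: "liminf (\<lambda>k. ennreal (v k)) \<noteq> \<infinity>"
  shows "\<exists>c. \<forall>k. v k \<le> c"
proof -
  obtain l where l: "(\<lambda>k. exp (- v k / 2)) \<longlonglongrightarrow> l"
    using conv by (auto simp: convergent_def)
  then have "l \<ge> 0" by (rule LIMSEQ_le_const) auto
  show ?thesis
  proof (cases "l = 0")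
    case True
    have "ennreal (real n) \<le> liminf (\<lambda>k. ennreal (v k))" for n
    proof (rule Liminf_bounded)
      have "eventually (\<lambda>k. exp (- v k / 2) < exp (- real n / 2)) sequentially"
        using order_tendstoD(2)[OF l, of "exp (- real n / 2)"] True by simp
      then show "eventually (\<lambda>k. ennreal (real n) \<le> ennreal (v k)) sequentially"
        by eventually_elim (auto intro: ennreal_leI)
    qed
    then have le: "of_nat n \<le> liminf (\<lambda>k. ennreal (v k))" for n
      by (simp add: ennreal_of_nat_eq_real_of_nat)
    have "liminf (\<lambda>k. ennreal (v k)) < top"
      using lim by (simp add: less_top)
    then obtain n where "liminf (\<lambda>k. ennreal (v k)) < of_nat n"
      using ennreal_Ex_less_of_nat by blast
    with le[of n] show ?thesis by simp
  next
    case False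
    with \<open>l \<ge> 0\<close> have "(\<lambda>k. -2 * ln (exp (- v k / 2))) \<longlonglongrightarrow> -2 * ln l"
      by (intro tendsto_intros l) simp
    then have "convergent v" by (auto simp: convergent_def)
    then show ?thesis
      using convergent_imp_Bseq Bseq_eq_bounded by (metis Bseq_iff abs_le_D1 real_norm_def)
  qed
qed

lemma ex_subseq_le:
  fixes u :: "nat \<Rightarrow> 'b::complete_linorder"
  assumes "liminf u < c"
  shows "\<exists>r :: nat \<Rightarrow> nat. strict_mono r \<and> (\<forall>n. u (r n) \<le> c)"
proof -
  have "infinite {n. u n \<le> c}"
  proof
    assume "finite {n. u n \<le> c}"
    then have "eventually (\<lambda>n. \<not> u n \<le> c) sequentially"
      by (simp add: cofinite_eq_sequentially[symmetric] eventually_cofinite)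
    then have "eventually (\<lambda>n. c \<le> u n) sequentially"
      by eventually_elim simp
    with assms show False using Liminf_bounded not_le by blast
  qed
  then have "strict_mono (enumerate {n. u n \<le> c}) \<and> (\<forall>n. u (enumerate {n. u n \<le> c} n) \<le> c)"
    using strict_mono_enumerate enumerate_in_set by blast
  then show ?thesis by blast
qed

lemma nn_integral_midpoint_le:
  assumes [measurable]: "v \<in> borel_measurable M" "w \<in> borel_measurable M"
    and v0: "\<And>s. 0 \<le> v s" and w0: "\<And>s. 0 \<le> w s"
  shows "(\<integral>\<^sup>+ s. ennreal (midpoint (v s) (w s)) \<partial>M)
    \<le> max (\<integral>\<^sup>+ s. ennreal (v s) \<partial>M) (\<integral>\<^sup>+ s. ennreal (w s) \<partial>M)" (is "_ \<le> ?m")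
proof -
  have "(\<integral>\<^sup>+ s. ennreal (midpoint (v s) (w s)) \<partial>M)
      = (\<integral>\<^sup>+ s. ennreal (1/2) * ennreal (v s) + ennreal (1/2) * ennreal (w s) \<partial>M)"
  proof (intro nn_integral_cong)
    fix s
    have half: "ennreal (1/2 * r) = ennreal (1/2) * ennreal r" if "0 \<le> r" for r
      using that by (intro ennreal_mult) auto
    have "midpoint (v s) (w s) = 1/2 * v s + 1/2 * w s"
      by (simp add: midpoint_def field_simps)
    also have "ennreal \<dots> = ennreal (1/2 * v s) + ennreal (1/2 * w s)"
      using v0 w0 by (intro ennreal_plus) auto
    finally show "ennreal (midpoint (v s) (w s)) = ennreal (1/2) * ennreal (v s) + ennreal (1/2) * ennreal (w s)"
      unfolding half[OF v0] half[OF w0] .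
  qed
  also have "\<dots> = ennreal (1/2) * (\<integral>\<^sup>+ s. ennreal (v s) \<partial>M) + ennreal (1/2) * (\<integral>\<^sup>+ s. ennreal (w s) \<partial>M)"
    by (simp add: nn_integral_add nn_integral_cmult)
  also have "\<dots> \<le> ennreal (1/2) * ?m + ennreal (1/2) * ?m"
    by (intro add_mono mult_left_mono) auto
  also have "\<dots> = ?m"
  proof -
    have "ennreal (1/2) + ennreal (1/2) = 1"
      by (subst ennreal_plus[symmetric]) auto
    then show ?thesis by (simp only: distrib_right[symmetric] mult_1)
  qed
  finally show ?thesis .
qed

section \<open>Borel spaces of topologies, marginals and product null sets\<close>

lemma space_borel_of [simp]: "space (borel_of X) = topspace X"
  unfolding borel_of_def by (subst space_measure_of) (auto dest: openin_subset)

lemma measurable_borel_of_continuous_map: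
  assumes "continuous_map X Y f"
  shows "f \<in> borel_of X \<rightarrow>\<^sub>M borel_of Y"
proof -
  have "f -` U \<inter> topspace X \<in> sets (borel_of X)" if "openin Y U" for U
  proof -
    have "f -` U \<inter> topspace X = {x \<in> topspace X. f x \<in> U}" by auto
    moreover have "openin X {x \<in> topspace X. f x \<in> U}"
      by (rule openin_continuous_map_preimage[OF assms that])
    ultimately show ?thesis
      unfolding borel_of_def by (auto dest: openin_subset intro: in_measure_of)
  qed
  moreover have "f \<in> topspace X \<rightarrow> topspace Y"
    using assms by (auto simp: continuous_map_def)
  ultimately show ?thesis
    unfolding borel_of_def[of Y] by (intro measurable_measure_of) (auto dest: openin_subset)
qed

text \<open>Resampling one coordinate of a point of a product probability space independently of the
  others does not change its distribution, so a null set of the product is almost surely avoided.\<close>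

lemma (in product_prob_space) AE_PiM_fun_upd:
  assumes fin: "finite K" and t: "t \<in> K" and P: "AE s in PiM K M. P s"
  shows "AE s in PiM K M. AE r in M t. P (s(t := r))"
proof -
  obtain N where N: "{s \<in> space (PiM K M). \<not> P s} \<subseteq> N" "emeasure (PiM K M) N = 0"
      and [measurable]: "N \<in> sets (PiM K M)"
    using P by (rule AE_E)
  define J where "J = K - {t}"
  have K: "K = insert t J" and J: "finite J" "t \<notin> J"
    using fin t by (auto simp: J_def)
  have N': "N \<in> sets (PiM (insert t J) M)" using \<open>N \<in> sets (PiM K M)\<close> K by simp
  have "0 = (\<integral>\<^sup>+ s. indicator N s \<partial>PiM (insert t J) M)"
    using N(2) N' K by simp
  also have "\<dots> = (\<integral>\<^sup>+ s. (\<integral>\<^sup>+ r. indicator N (s(t := r)) \<partial>M t) \<partial>PiM J M)"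
    by (intro product_nn_integral_insert J borel_measurable_indicator N')
  finally have 0: "(\<integral>\<^sup>+ s. (\<integral>\<^sup>+ r. indicator N (s(t := r)) \<partial>M t) \<partial>PiM J M) = 0" ..
  have upd: "(\<lambda>(s, r). s(t := r)) \<in> PiM J M \<Otimes>\<^sub>M M t \<rightarrow>\<^sub>M PiM (insert t J) M"
    by (rule measurable_add_dim)
  have ind: "(\<lambda>(s, r). indicator N (s(t := r)) :: ennreal) \<in> borel_measurable (PiM J M \<Otimes>\<^sub>M M t)"
    using measurable_compose[OF upd, of "indicator N" borel] N' by (simp add: case_prod_beta')
  have "(\<lambda>s. \<integral>\<^sup>+ r. indicator N (s(t := r)) \<partial>M t) \<in> borel_measurable (PiM J M)"
    using ind by (rule sigma_finite_measure.borel_measurable_nn_integral[OF sigma_finite_measures])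
  then have "AE s in PiM J M. (\<integral>\<^sup>+ r. indicator N (s(t := r)) \<partial>M t) = 0"
    using 0 by (simp add: nn_integral_0_iff_AE)
  then have "AE s in PiM J M. AE r in M t. s(t := r) \<notin> N"
  proof (rule AE_mp[OF _ AE_I2[OF impI]])
    fix s assume s: "s \<in> space (PiM J M)" and "(\<integral>\<^sup>+ r. indicator N (s(t := r)) \<partial>M t) = 0"
    moreover have "(\<lambda>r. indicator N (s(t := r)) :: ennreal) \<in> borel_measurable (M t)"
      using measurable_compose[OF measurable_Pair1'[OF s] ind] by simp
    ultimately show "AE r in M t. s(t := r) \<notin> N"
      by (simp add: nn_integral_0_iff_AE indicator_eq_0_iff)
  qed
  moreover have "PiM J M = distr (PiM K M) (PiM J M) (\<lambda>s. restrict s J)"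
    by (rule distr_restrict[OF _ fin]) (simp add: J_def)
  ultimately have "AE s in distr (PiM K M) (PiM J M) (\<lambda>s. restrict s J). AE r in M t. s(t := r) \<notin> N"
    by (rule back_subst[where P = "\<lambda>M'. AE s in M'. AE r in M t. s(t := r) \<notin> N"])
  then have "AE s in PiM K M. AE r in M t. (restrict s J)(t := r) \<notin> N"
    by (rule AE_distrD[where P = "\<lambda>s. AE r in M t. s(t := r) \<notin> N", rotated])
       (auto simp: J_def intro: measurable_restrict_subset)
  then show ?thesis
  proof (rule AE_mp[OF _ AE_I2[OF impI]])
    fix s :: "'i \<Rightarrow> 'a" assume s: "s \<in> space (PiM K M)" and ae: "AE r in M t. (restrict s J)(t := r) \<notin> N"
    show "AE r in M t. P (s(t := r))"
    proof (rule AE_mp[OF ae], intro AE_I2 impI)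
      fix r assume r: "r \<in> space (M t)" and "(restrict s J)(t := r) \<notin> N"
      moreover have "(restrict s J)(t := r) = s(t := r)"
        using s by (auto simp: fun_eq_iff K space_PiM PiE_def extensional_def)
      moreover have "s(t := r) \<in> space (PiM K M)"
        using s r t by (auto simp: space_PiM PiE_iff extensional_def)
      ultimately show "P (s(t := r))" using N(1) by auto
    qed
  qed
qed

text \<open>The data of the minimization problem, with the integrable lower bound \<open>m\<close> fixed. The hypothesis
  on recession functions makes the integrand a function of the sum of the components, coercive in
  that sum.\<close>

locale sum_coercive_problem =
  fixes S :: "'t::finite \<Rightarrow> 'a topology"
    and \<mu> :: "('t \<Rightarrow> 'a) measure"
    and f :: "real^'d^'t \<Rightarrow> ('t \<Rightarrow> 'a) \<Rightarrow> ereal"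
    and m :: "('t \<Rightarrow> 'a) \<Rightarrow> real"
  assumes prob: "prob_space \<mu>"
    and sets_mu: "sets \<mu> = sets (borel_of (prod_space S))"
    and integrand: "convex_normal_integrand (borel_of (prod_space S)) f"
    and ac: "absolutely_continuous \<mu> (PiM UNIV (marginal S \<mu>))"
    and integrable_m: "integrable \<mu> m"
    and lower_bound: "AE s in \<mu>. \<forall>x. ereal (m s) \<le> f x s"
    and recession: "\<And>s. s \<in> topspace (prod_space S) \<Longrightarrow>
          {x. recession_fun (\<lambda>z. f z s) x \<le> 0} = zero_sum"
begin

sublocale prob_space \<mu> by (rule prob)

abbreviation "\<nu> \<equiv> marginal S \<mu>"

lemma space_mu: "space \<mu> = topspace (prod_space S)"
  by (simp only: sets_eq_imp_space_eq[OF sets_mu] space_borel_of)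

lemma space_nu [simp]: "space (\<nu> t) = topspace (S t)"
  by (simp add: marginal_def)

lemma sets_nu [measurable_cong]: "sets (\<nu> t) = sets (borel_of (S t))"
  by (simp add: marginal_def)

lemma measurable_component: "(\<lambda>s. s t) \<in> \<mu> \<rightarrow>\<^sub>M borel_of (S t)"
  unfolding measurable_cong_sets[OF sets_mu refl]
  by (intro measurable_borel_of_continuous_map continuous_map_product_projection) simp

sublocale nu: product_prob_space \<nu> UNIV
  unfolding marginal_def by (intro product_prob_spaceI prob_space_distr measurable_component)

lemma AE_component: "AE r in \<nu> t. P r \<Longrightarrow> AE s in \<mu>. P (s t)"
  unfolding marginal_def by (rule AE_distrD[OF measurable_component])

lemma AE_components:
  assumes "\<And>t. AE r in \<nu> t. P t r"
  shows "AE s in \<mu>. \<forall>t. P t (s t)"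
  using AE_component[OF assms] by (simp add: AE_all_countable)

lemma AE_PiM_if_AE:
  assumes "AE s in \<mu>. P s"
  shows "AE s in PiM UNIV \<nu>. P s"
proof -
  obtain N where N: "{s \<in> space \<mu>. \<not> P s} \<subseteq> N" "emeasure \<mu> N = 0" "N \<in> sets \<mu>"
    using assms by (rule AE_E)
  then have "N \<in> null_sets (PiM UNIV \<nu>)"
    using ac unfolding absolutely_continuous_def by blast
  moreover have "space (PiM UNIV \<nu>) = space \<mu>"
    by (simp add: space_PiM space_mu)
  ultimately show ?thesis
    using N(1) by (intro AE_I'[of N]) auto
qed

section \<open>The feasible set and the objective\<close>

lemma closed_epi: "s \<in> space \<mu> \<Longrightarrow> closed (epi (\<lambda>x. f x s))"
  and convex_epi: "s \<in> space \<mu> \<Longrightarrow> convex (epi (\<lambda>x. f x s))"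
  using integrand by (auto simp: convex_normal_integrand_def space_mu)

lemma recession_space: "s \<in> space \<mu> \<Longrightarrow> {x. recession_fun (\<lambda>z. f z s) x \<le> 0} = zero_sum"
  unfolding space_mu by (rule recession)

lemma integrand_add_zero_sum: "s \<in> space \<mu> \<Longrightarrow> d \<in> zero_sum \<Longrightarrow> f (x + d) s = f x s"
  by (rule zero_sum_invariant[of "\<lambda>x. f x s"]) (simp_all add: closed_epi convex_epi recession_space)

lemma borel_measurable_eval_path:
  fixes x :: "'t \<Rightarrow> 'a \<Rightarrow> real^'d"
  assumes "\<And>t. x t \<in> borel_measurable (borel_of (S t))"
  shows "eval_path x \<in> borel_measurable \<mu>"
proof -
  have [measurable]: "(\<lambda>s. x t (s t)) \<in> borel_measurable \<mu>" for t
    by (rule measurable_compose[OF measurable_component assms])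
  show ?thesis
  proof (rule borel_measurable_euclidean_space[THEN iffD2], rule ballI)
    fix i :: "real^'d^'t" assume "i \<in> Basis"
    then obtain t u where "i = axis t u" by (auto simp: Basis_vec_def)
    then have "(\<lambda>s. eval_path x s \<bullet> i) = (\<lambda>s. x t (s t) \<bullet> u)"
      by (simp add: inner_axis eval_path_def)
    moreover have "(\<lambda>s. x t (s t) \<bullet> u) \<in> borel_measurable \<mu>" by measurable
    ultimately show "(\<lambda>s. eval_path x s \<bullet> i) \<in> borel_measurable \<mu>" by (simp only:)
  qed
qed

lemma borel_measurable_integrand:
  assumes "\<And>t. x t \<in> borel_measurable (borel_of (S t))"
  shows "(\<lambda>s. f (eval_path x s) s) \<in> borel_measurable \<mu>"
proof -
  note cong = measurable_cong_sets[OF sets_mu refl]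
  show ?thesis
    unfolding cong
    by (rule borel_measurable_normal_integrand[OF integrand])
       (rule borel_measurable_eval_path[unfolded cong, OF assms])
qed

lemma feasible_measurable: "x \<in> feasible S \<mu> f \<Longrightarrow> x t \<in> borel_measurable (borel_of (S t))"
  by (simp add: feasible_def)

text \<open>In the next two rules the sets \<open>A t\<close> of full measure in the definition of feasibility are replaced
  by properties \<open>P t\<close> that hold almost everywhere.\<close>

lemma feasibleI:
  assumes "\<And>t. x t \<in> borel_measurable (borel_of (S t))"
    and P: "\<And>t. AE r in \<nu> t. P t r"
    and "\<And>s. s \<in> space \<mu> \<Longrightarrow> (\<And>t. P t (s t)) \<Longrightarrow> eval_path x s \<in> closure (edom (\<lambda>z. f z s))"
  shows "x \<in> feasible S \<mu> f"
proof -
  have "\<exists>A\<in>sets (\<nu> t). emeasure (\<nu> t) A = 1 \<and> (\<forall>r\<in>A. P t r)" for t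
  proof -
    obtain N where N: "{r \<in> space (\<nu> t). \<not> P t r} \<subseteq> N" "emeasure (\<nu> t) N = 0" "N \<in> sets (\<nu> t)"
      using P by (rule AE_E)
    then have "AE r in \<nu> t. r \<in> space (\<nu> t) - N"
      by (intro AE_I'[of N]) auto
    then have "emeasure (\<nu> t) (space (\<nu> t) - N) = 1"
      using N(3) by (intro nu.M.emeasure_eq_1_AE sets.compl_sets)
    moreover have "space (\<nu> t) - N \<in> sets (\<nu> t)"
      using N(3) by (rule sets.compl_sets)
    ultimately show ?thesis using N(1) by blast
  qed
  then obtain A where A: "\<And>t. A t \<in> sets (\<nu> t)" "\<And>t. emeasure (\<nu> t) (A t) = 1"
      "\<And>t r. r \<in> A t \<Longrightarrow> P t r"
    by metis
  have "eval_path x s \<in> closure (edom (\<lambda>z. f z s))" if "s \<in> PiE UNIV A" for s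
  proof (rule assms(3))
    show "P t (s t)" for t using that A(3) by auto
    have "s t \<in> topspace (S t)" for t
      using that sets.sets_into_space[OF A(1)[of t]] by auto
    then show "s \<in> space \<mu>" by (simp add: space_mu PiE_iff)
  qed
  with A assms(1) show ?thesis
    unfolding feasible_def mem_Collect_eq sets_nu by (intro conjI allI exI[of _ A]) blast+
qed

lemma feasibleE:
  assumes "x \<in> feasible S \<mu> f"
  obtains P where "\<And>t. AE r in \<nu> t. P t r"
    and "\<And>s. s \<in> space \<mu> \<Longrightarrow> (\<And>t. P t (s t)) \<Longrightarrow> eval_path x s \<in> closure (edom (\<lambda>z. f z s))"
proof -
  obtain A where A: "\<And>t. A t \<in> sets (borel_of (S t))" "\<And>t. emeasure (\<nu> t) (A t) = 1"
      and cl: "\<And>s. s \<in> PiE UNIV A \<Longrightarrow> eval_path x s \<in> closure (edom (\<lambda>z. f z s))"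
    using assms unfolding feasible_def by blast
  have "AE r in \<nu> t. r \<in> A t" for t
    using A(2)[of t] by (intro nu.M.AE_prob_1) (simp add: measure_def)
  then show thesis
    by (rule that[of "\<lambda>t r. r \<in> A t"]) (auto intro!: cl)
qed

text \<open>The pointwise midpoint of two paths. The feasible set and the sublevel sets of the objective are
  closed under this operation, and no other convex combination of paths is needed.\<close>

definition midpath :: "('t \<Rightarrow> 'a \<Rightarrow> real^'d) \<Rightarrow> ('t \<Rightarrow> 'a \<Rightarrow> real^'d) \<Rightarrow> 't \<Rightarrow> 'a \<Rightarrow> real^'d" where
  "midpath x y = (\<lambda>t r. midpoint (x t r) (y t r))"

lemma eval_path_midpath: "eval_path (midpath x y) s = midpoint (eval_path x s) (eval_path y s)"
  by (simp add: eval_path_def midpath_def midpoint_def vec_eq_iff)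

lemma feasible_midpath:
  assumes x: "x \<in> feasible S \<mu> f" and y: "y \<in> feasible S \<mu> f"
  shows "midpath x y \<in> feasible S \<mu> f"
proof -
  obtain P where P: "\<And>t. AE r in \<nu> t. P t r"
    and clP: "\<And>s. s \<in> space \<mu> \<Longrightarrow> (\<And>t. P t (s t)) \<Longrightarrow> eval_path x s \<in> closure (edom (\<lambda>z. f z s))"
    using feasibleE[OF x] by blast
  obtain Q where Q: "\<And>t. AE r in \<nu> t. Q t r"
    and clQ: "\<And>s. s \<in> space \<mu> \<Longrightarrow> (\<And>t. Q t (s t)) \<Longrightarrow> eval_path y s \<in> closure (edom (\<lambda>z. f z s))"
    using feasibleE[OF y] by blast
  note [measurable] = feasible_measurable[OF x] feasible_measurable[OF y]
  show ?thesis
  proof (rule feasibleI)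
    show "midpath x y t \<in> borel_measurable (borel_of (S t))" for t
      unfolding midpath_def midpoint_def by measurable
    show "AE r in \<nu> t. P t r \<and> Q t r" for t
      using P Q by simp
    show "eval_path (midpath x y) s \<in> closure (edom (\<lambda>z. f z s))"
      if "s \<in> space \<mu>" "\<And>t. P t (s t) \<and> Q t (s t)" for s
      unfolding eval_path_midpath
      by (intro midpoint_in_convex convex_closure convex_edom convex_epi clP clQ) (use that in auto)
  qed
qed

text \<open>Shifting the components of a path by constants that add up to zero changes nothing.\<close>

lemma eval_path_shift: "eval_path (\<lambda>t r. x t r + c t) s = eval_path x s + (\<chi> t. c t)"
  by (simp add: eval_path_def vec_eq_iff)

lemma feasible_shift:
  assumes x: "x \<in> feasible S \<mu> f" and c: "(\<chi> t. c t) \<in> zero_sum"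
  shows "(\<lambda>t r. x t r + c t) \<in> feasible S \<mu> f"
proof -
  obtain P where P: "\<And>t. AE r in \<nu> t. P t r"
    and clP: "\<And>s. s \<in> space \<mu> \<Longrightarrow> (\<And>t. P t (s t)) \<Longrightarrow> eval_path x s \<in> closure (edom (\<lambda>z. f z s))"
    using feasibleE[OF x] by blast
  note [measurable] = feasible_measurable[OF x]
  show ?thesis
  proof (rule feasibleI[OF _ P])
    show "(\<lambda>r. x t r + c t) \<in> borel_measurable (borel_of (S t))" for t
      by measurable
    fix s assume s: "s \<in> space \<mu>" and "\<And>t. P t (s t)"
    let ?E = "edom (\<lambda>z. f z s)" and ?c = "\<chi> t. c t"
    have "(+) ?c ` ?E \<subseteq> ?E"
      using integrand_add_zero_sum[OF s c] by (auto simp: edom_def add.commute)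
    then have "(+) ?c ` closure ?E \<subseteq> closure ?E"
      using closure_mono closure_translation by metis
    then have "?c + eval_path x s \<in> closure ?E"
      using clP[OF s \<open>\<And>t. P t (s t)\<close>] by blast
    then show "eval_path (\<lambda>t r. x t r + c t) s \<in> closure ?E"
      by (subst eval_path_shift) (simp only: add.commute)
  qed
qed

text \<open>The excess of the integrand along a path over the lower bound \<open>m\<close>; truncation at \<open>0\<close> by
  \<open>e2ennreal\<close> has no effect where the lower bound holds, which is almost everywhere.\<close>

definition excess :: "('t \<Rightarrow> 'a \<Rightarrow> real^'d) \<Rightarrow> ('t \<Rightarrow> 'a) \<Rightarrow> ennreal" where
  "excess x s = e2ennreal (f (eval_path x s) s - ereal (m s))"

text \<open>The integrated excess. For feasible paths the objective is obtained from it by adding the finite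
  constant \<open>\<integral> m\<close>.\<close>

definition total :: "('t \<Rightarrow> 'a \<Rightarrow> real^'d) \<Rightarrow> ennreal" where
  "total x = (\<integral>\<^sup>+ s. excess x s \<partial>\<mu>)"

lemma borel_measurable_excess:
  assumes "x \<in> feasible S \<mu> f"
  shows "excess x \<in> borel_measurable \<mu>"
proof -
  have [measurable]: "(\<lambda>s. f (eval_path x s) s) \<in> borel_measurable \<mu>" "m \<in> borel_measurable \<mu>"
    using borel_measurable_integrand feasible_measurable[OF assms] integrable_m by auto
  show ?thesis unfolding excess_def[abs_def] by measurable
qed

lemma total_shift:
  assumes "(\<chi> t. c t) \<in> zero_sum"
  shows "total (\<lambda>t r. x t r + c t) = total x"
  unfolding total_def excess_def eval_path_shift
  by (intro nn_integral_cong) (simp add: integrand_add_zero_sum[OF _ assms])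

lemma objective_eq_total:
  assumes x: "x \<in> feasible S \<mu> f"
  shows "objective \<mu> f x = enn2ereal (total x) + ereal (\<integral>s. m s \<partial>\<mu>)"
proof -
  define g where "g s = f (eval_path x s) s" for s
  have [measurable]: "g \<in> borel_measurable \<mu>" "m \<in> borel_measurable \<mu>"
    using borel_measurable_integrand feasible_measurable[OF x] integrable_m
    unfolding g_def by auto
  have ge: "AE s in \<mu>. ereal (m s) \<le> g s"
    using lower_bound by eventually_elim (simp add: g_def)
  let ?p = "\<integral>\<^sup>+ s. e2ennreal (g s) \<partial>\<mu>" and ?n = "\<integral>\<^sup>+ s. e2ennreal (- g s) \<partial>\<mu>"
  let ?mp = "\<integral>\<^sup>+ s. ennreal (m s) \<partial>\<mu>" and ?mn = "\<integral>\<^sup>+ s. ennreal (- m s) \<partial>\<mu>"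
  have "?p + ?mn = (\<integral>\<^sup>+ s. e2ennreal (g s) + ennreal (- m s) \<partial>\<mu>)"
    by (simp add: nn_integral_add)
  \<comment> \<open>\<open>g\<^sup>+ + m\<^sup>- = (g - m) + g\<^sup>- + m\<^sup>+\<close>, which avoids differences of infinite values\<close>
  also have "\<dots> = (\<integral>\<^sup>+ s. (excess x s + e2ennreal (- g s)) + ennreal (m s) \<partial>\<mu>)"
  proof (intro nn_integral_cong_AE, use ge in eventually_elim)
    case (elim s)
    show ?case
    proof (cases "g s")
      case (real r)
      with elim have "m s \<le> r" by simp
      have "ennreal r + ennreal (- m s) = ennreal (r - m s) + ennreal (- r) + ennreal (m s)"
        using \<open>m s \<le> r\<close>
        by (cases "0 \<le> r"; cases "0 \<le> m s")
           (auto simp: ennreal_neg ennreal_plus[symmetric] simp del: ennreal_plus)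
      then show ?thesis using real by (simp add: excess_def g_def)
    qed (use elim in \<open>auto simp: excess_def g_def\<close>)
  qed
  also have "\<dots> = total x + ?n + ?mp"
    using borel_measurable_excess[OF x] by (simp add: nn_integral_add total_def)
  finally have eq: "?p + ?mn = total x + ?n + ?mp" .
  have m: "?mp \<noteq> \<infinity>" "?mn \<noteq> \<infinity>" "(\<integral>s. m s \<partial>\<mu>) = enn2real ?mp - enn2real ?mn"
    using integrable_m real_integrable_def[of \<mu> m] real_lebesgue_integral_def[of \<mu> m] by auto
  have "?n \<le> ?mn"
    using ge by (intro nn_integral_mono_AE) (auto elim!: eventually_mono intro!: e2ennreal_mono
        simp flip: e2ennreal_ereal uminus_ereal.simps)
  with m have n: "?n \<noteq> \<infinity>" by (auto simp: top_unique)
  have "enn2ereal ?p - enn2ereal ?n = enn2ereal (total x) + ereal (enn2real ?mp - enn2real ?mn)"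
    using eq m(1,2) n
    by (cases ?p; cases ?n; cases "total x"; cases ?mp; cases ?mn)
       (auto simp: enn2ereal_ennreal ennreal_plus[symmetric] top_add add_top simp del: ennreal_plus)
  then show ?thesis
    by (simp add: objective_def ereal_integral_def g_def m(3))
qed

section \<open>Minimizing sequences\<close>

lemma integrand_midpath_le:
  assumes s: "s \<in> space \<mu>"
    and "f (eval_path x s) s \<le> ereal a" "f (eval_path y s) s \<le> ereal b"
  shows "f (eval_path (midpath x y) s) s \<le> ereal (midpoint a b)"
proof -
  have "midpoint (eval_path x s, a) (eval_path y s, b) \<in> epi (\<lambda>z. f z s)"
    by (rule midpoint_in_convex[OF convex_epi[OF s]]) (use assms in \<open>auto simp: epi_def\<close>)
  then show ?thesis
    by (simp add: eval_path_midpath epi_def midpoint_def)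
qed

lemma total_le:
  assumes "AE s in \<mu>. f (eval_path x s) s \<le> ereal (m s + v s)"
  shows "total x \<le> (\<integral>\<^sup>+ s. ennreal (v s) \<partial>\<mu>)"
  unfolding total_def
proof (rule nn_integral_mono_AE)
  show "AE s in \<mu>. excess x s \<le> ennreal (v s)"
    using assms
  proof eventually_elim
    case (elim s)
    then have "f (eval_path x s) s - ereal (m s) \<le> ereal (v s)"
      by (cases "f (eval_path x s) s") auto
    then show ?case
      unfolding excess_def e2ennreal_ereal[symmetric] by (rule e2ennreal_mono)
  qed
qed

lemma ex_real_bound_if_total_finite:
  assumes x: "x \<in> feasible S \<mu> f" and fin: "total x \<noteq> \<infinity>"
  obtains v where "v \<in> borel_measurable \<mu>" "\<And>s. 0 \<le> v s"
    "AE s in \<mu>. f (eval_path x s) s \<le> ereal (m s + v s)"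
    "(\<integral>\<^sup>+ s. ennreal (v s) \<partial>\<mu>) = total x"
proof
  note [measurable] = borel_measurable_excess[OF x]
  let ?v = "\<lambda>s. enn2real (excess x s)"
  show "?v \<in> borel_measurable \<mu>" by measurable
  show "0 \<le> ?v s" for s by simp
  have "AE s in \<mu>. excess x s \<noteq> \<infinity>"
    using fin unfolding total_def by (intro nn_integral_noteq_infinite) auto
  then have v: "AE s in \<mu>. ennreal (?v s) = excess x s"
    by eventually_elim (simp add: ennreal_enn2real less_top)
  show "(\<integral>\<^sup>+ s. ennreal (?v s) \<partial>\<mu>) = total x"
    unfolding total_def by (rule nn_integral_cong_AE[OF v])
  show "AE s in \<mu>. f (eval_path x s) s \<le> ereal (m s + ?v s)"
    using v lower_bound
  proof eventually_elim
    case (elim s)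
    then have le: "ereal (m s) \<le> f (eval_path x s) s" by simp
    then have "0 \<le> f (eval_path x s) s - ereal (m s)"
      by (cases "f (eval_path x s) s") auto
    then have "f (eval_path x s) s - ereal (m s) = enn2ereal (excess x s)"
      by (simp add: excess_def enn2ereal_e2ennreal)
    also have "\<dots> = ereal (?v s)"
      using elim(1) by (metis enn2ereal_ennreal enn2real_nonneg)
    finally show ?case
      by (cases "f (eval_path x s) s") auto
  qed
qed

lemma AE_integrand_midpath_le:
  assumes "AE s in \<mu>. f (eval_path x s) s \<le> ereal (m s + v s)"
    and "AE s in \<mu>. f (eval_path y s) s \<le> ereal (m s + w s)"
  shows "AE s in \<mu>. f (eval_path (midpath x y) s) s \<le> ereal (m s + midpoint (v s) (w s))"
  using assms AE_space
proof eventually_elim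
  case (elim s)
  have "midpoint (m s + v s) (m s + w s) = m s + midpoint (v s) (w s)"
    by (simp add: midpoint_def field_simps)
  with integrand_midpath_le[OF elim(3,1,2)] show ?case by simp
qed

lemma total_midpath_le:
  assumes x: "x \<in> feasible S \<mu> f" and y: "y \<in> feasible S \<mu> f"
  shows "total (midpath x y) \<le> max (total x) (total y)"
proof (cases "total x = \<infinity> \<or> total y = \<infinity>")
  case False
  then have "total x \<noteq> \<infinity>" "total y \<noteq> \<infinity>" by auto
  obtain v where [measurable]: "v \<in> borel_measurable \<mu>" and v0: "\<And>s. 0 \<le> v s"
    and fv: "AE s in \<mu>. f (eval_path x s) s \<le> ereal (m s + v s)"
    and Iv: "(\<integral>\<^sup>+ s. ennreal (v s) \<partial>\<mu>) = total x"
    using ex_real_bound_if_total_finite[OF x \<open>total x \<noteq> \<infinity>\<close>] by blast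
  obtain w where [measurable]: "w \<in> borel_measurable \<mu>" and w0: "\<And>s. 0 \<le> w s"
    and fw: "AE s in \<mu>. f (eval_path y s) s \<le> ereal (m s + w s)"
    and Iw: "(\<integral>\<^sup>+ s. ennreal (w s) \<partial>\<mu>) = total y"
    using ex_real_bound_if_total_finite[OF y \<open>total y \<noteq> \<infinity>\<close>] by blast
  have "total (midpath x y) \<le> (\<integral>\<^sup>+ s. ennreal (midpoint (v s) (w s)) \<partial>\<mu>)"
    by (rule total_le[OF AE_integrand_midpath_le[OF fv fw]])
  also have "\<dots> \<le> max (total x) (total y)"
    unfolding Iv[symmetric] Iw[symmetric] by (rule nn_integral_midpoint_le) (auto intro: v0 w0)
  finally show ?thesis .
qed auto

lemma excess_le_iff:
  assumes "0 \<le> b"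
  shows "excess x s \<le> ennreal b \<longleftrightarrow> f (eval_path x s) s \<le> ereal (m s + b)"
proof (cases "f (eval_path x s) s")
  case (real r)
  then have "excess x s = ennreal (r - m s)" by (simp add: excess_def)
  then show ?thesis using assms real by (auto simp: ennreal_le_iff)
next
  case MInf
  then have "excess x s = 0" by (simp add: excess_def e2ennreal_neg)
  with MInf show ?thesis by simp
qed (simp add: excess_def top_unique)

text \<open>The integrand is lower semicontinuous at each point, because its epigraph is closed.\<close>

lemma excess_liminf:
  assumes s: "s \<in> space \<mu>" and lim: "(\<lambda>n. eval_path (x n) s) \<longlonglongrightarrow> eval_path z s"
  shows "excess z s \<le> liminf (\<lambda>n. excess (x n) s)"
proof (rule ccontr)
  assume "\<not> excess z s \<le> liminf (\<lambda>n. excess (x n) s)"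
  then have "liminf (\<lambda>n. excess (x n) s) < excess z s" by simp
  then obtain c where c: "liminf (\<lambda>n. excess (x n) s) < c" "c < excess z s"
    using dense by blast
  then obtain b where b: "c = ennreal b" "0 \<le> b"
    by (cases c) auto
  obtain r :: "nat \<Rightarrow> nat" where r: "strict_mono r" "\<And>n. excess (x (r n)) s \<le> ennreal b"
    using ex_subseq_le[OF c(1)[unfolded b(1)]] by blast
  have "f (eval_path (x (r n)) s) s \<le> ereal (m s + b)" for n
    using r(2)[of n] \<open>0 \<le> b\<close> by (simp add: excess_le_iff)
  then have "(eval_path (x (r n)) s, m s + b) \<in> epi (\<lambda>z. f z s)" for n
    by (simp add: epi_def)
  moreover have "(\<lambda>n. (eval_path (x (r n)) s, m s + b)) \<longlonglongrightarrow> (eval_path z s, m s + b)"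
    using LIMSEQ_subseq_LIMSEQ[OF lim r(1)] by (intro tendsto_intros) (simp add: o_def)
  ultimately have "(eval_path z s, m s + b) \<in> epi (\<lambda>z. f z s)"
    by (rule closed_sequentially[OF closed_epi[OF s]])
  then have "excess z s \<le> ennreal b"
    using \<open>0 \<le> b\<close> by (simp add: excess_le_iff epi_def)
  with c(2) b show False by simp
qed

text \<open>For \<open>v, w \<ge> 0\<close> the transform \<open>a = exp (- v / 2)\<close> satisfies a parallelogram inequality because
  \<open>a\<^sup>2\<close> at the midpoint is the product of the two values. Hence the integrands \<open>v\<close> of a suitable
  minimizing sequence converge in \<open>[0, \<infinity>]\<close>, and by Fatou's lemma they stay bounded.\<close>

lemma bounded_minimizing_sequence:
  assumes "I \<noteq> \<infinity>"
    and min: "\<And>n. \<exists>x\<in>feasible S \<mu> f. total x \<le> I + ennreal (1 / Suc n)"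
  obtains x where "\<And>n. x n \<in> feasible S \<mu> f" "\<And>n. total (x n) \<le> I + ennreal (1 / Suc n)"
    "AE s in \<mu>. bounded (range (\<lambda>n. \<Sum>t\<in>UNIV. x n t (s t)))"
proof -
  define C where "C n = {(x, v). x \<in> feasible S \<mu> f \<and> v \<in> borel_measurable \<mu> \<and> (\<forall>s. 0 \<le> v s)
      \<and> (AE s in \<mu>. f (eval_path x s) s \<le> ereal (m s + v s))
      \<and> (\<integral>\<^sup>+ s. ennreal (v s) \<partial>\<mu>) \<le> I + ennreal (1 / Suc n)}" for n
  \<comment> \<open>Paths are paired with real upper bounds \<open>v\<close> of their excess, and midpoints are taken in both
    components, since the transform is applied to \<open>v\<close> and not to the convex function itself.\<close>
  define mid where "mid = (\<lambda>(x, v :: ('t \<Rightarrow> 'a) \<Rightarrow> real) (y, w). (midpath x y, \<lambda>s. midpoint (v s) (w s)))"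
  define a where "a = (\<lambda>(x :: 't \<Rightarrow> 'a \<Rightarrow> real^'d, v :: ('t \<Rightarrow> 'a) \<Rightarrow> real) s. exp (- v s / 2))"
  have ne: "C n \<noteq> {}" for n
  proof -
    obtain x where x: "x \<in> feasible S \<mu> f" and tot: "total x \<le> I + ennreal (1 / Suc n)"
      using min by blast
    moreover have "total x \<noteq> \<infinity>"
      using tot \<open>I \<noteq> \<infinity>\<close> by (auto simp: top_unique)
    ultimately obtain v where "v \<in> borel_measurable \<mu>" "\<And>s. 0 \<le> v s"
      "AE s in \<mu>. f (eval_path x s) s \<le> ereal (m s + v s)" "(\<integral>\<^sup>+ s. ennreal (v s) \<partial>\<mu>) = total x"
      using ex_real_bound_if_total_finite[OF x] by blast
    with x tot have "(x, v) \<in> C n"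
      by (simp add: C_def)
    then show ?thesis by blast
  qed
  have dec: "decseq C"
  proof (rule decseq_SucI)
    fix n
    have "I + ennreal (1 / Suc (Suc n)) \<le> I + ennreal (1 / Suc n)"
      by (intro add_left_mono ennreal_leI) (simp add: field_simps)
    then show "C (Suc n) \<subseteq> C n"
      unfolding C_def by (blast intro: order_trans)
  qed
  have mid: "mid p q \<in> C n" if "p \<in> C n" "q \<in> C n" for p q n
  proof -
    obtain x v y w where p: "p = (x, v)" and q: "q = (y, w)" by (cases p, cases q)
    have x: "x \<in> feasible S \<mu> f" and [measurable]: "v \<in> borel_measurable \<mu>" and v0: "\<And>s. 0 \<le> v s"
      and fv: "AE s in \<mu>. f (eval_path x s) s \<le> ereal (m s + v s)"
      and Iv: "(\<integral>\<^sup>+ s. ennreal (v s) \<partial>\<mu>) \<le> I + ennreal (1 / Suc n)"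
      using that(1) by (auto simp: p C_def)
    have y: "y \<in> feasible S \<mu> f" and [measurable]: "w \<in> borel_measurable \<mu>" and w0: "\<And>s. 0 \<le> w s"
      and fw: "AE s in \<mu>. f (eval_path y s) s \<le> ereal (m s + w s)"
      and Iw: "(\<integral>\<^sup>+ s. ennreal (w s) \<partial>\<mu>) \<le> I + ennreal (1 / Suc n)"
      using that(2) by (auto simp: q C_def)
    have "(\<lambda>s. midpoint (v s) (w s)) \<in> borel_measurable \<mu>"
      unfolding midpoint_def by measurable
    moreover have "AE s in \<mu>. f (eval_path (midpath x y) s) s \<le> ereal (m s + midpoint (v s) (w s))"
      by (rule AE_integrand_midpath_le[OF fv fw])
    moreover have "(\<integral>\<^sup>+ s. ennreal (midpoint (v s) (w s)) \<partial>\<mu>) \<le> I + ennreal (1 / Suc n)"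
    proof (rule order_trans[OF nn_integral_midpoint_le])
      show "max (\<integral>\<^sup>+ s. ennreal (v s) \<partial>\<mu>) (\<integral>\<^sup>+ s. ennreal (w s) \<partial>\<mu>) \<le> I + ennreal (1 / Suc n)"
        using Iv Iw by (rule max.boundedI)
    qed (auto intro: v0 w0)
    ultimately show ?thesis
      using feasible_midpath[OF x y] v0 w0 by (auto simp: p q mid_def C_def midpoint_def)
  qed
  have meas: "a p \<in> borel_measurable \<mu>" if "p \<in> C 0" for p
    using that by (auto simp: C_def a_def)
  have bnd: "AE s in \<mu>. norm (a p s) \<le> 1" if "p \<in> C 0" for p
    using that by (auto simp: C_def a_def)
  have para: "(norm (a q s - a p s))\<^sup>2 / 4
      \<le> ((norm (a p s))\<^sup>2 + (norm (a q s))\<^sup>2) / 2 - (norm (a (mid p q) s))\<^sup>2" for p q s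
  proof -
    obtain x v y w where p: "p = (x, v)" and q: "q = (y, w)" by (cases p, cases q)
    have "(a (mid p q) s)\<^sup>2 = a p s * a q s"
      by (simp add: p q a_def mid_def midpoint_def power2_eq_square exp_add[symmetric] field_simps)
    then have "((norm (a p s))\<^sup>2 + (norm (a q s))\<^sup>2) / 2 - (norm (a (mid p q) s))\<^sup>2
        = (a q s - a p s)\<^sup>2 / 2"
      by (simp add: power2_eq_square field_simps)
    moreover have "(norm (a q s - a p s))\<^sup>2 / 4 \<le> (a q s - a p s)\<^sup>2 / 2" by simp
    ultimately show ?thesis by (simp only:)
  qed
  obtain g where g: "\<And>n. g n \<in> C n" and conv: "AE s in \<mu>. convergent (\<lambda>n. a (g n) s)"
    using AE_convergent_midpoint_minimizers[OF finite_measure_axioms ne dec mid meas bnd para] by blast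
  define x where "x n = fst (g n)" for n
  define v where "v n = snd (g n)" for n
  have gC: "(x n, v n) \<in> C n" for n
    using g[of n] by (simp add: x_def v_def)
  have x: "x n \<in> feasible S \<mu> f" and [measurable]: "v n \<in> borel_measurable \<mu>" and v0: "0 \<le> v n s"
    and fv: "AE s in \<mu>. f (eval_path (x n) s) s \<le> ereal (m s + v n s)"
    and Iv: "(\<integral>\<^sup>+ s. ennreal (v n s) \<partial>\<mu>) \<le> I + ennreal (1 / Suc n)" for n s
    using gC[of n] unfolding C_def by auto
  have "(\<integral>\<^sup>+ s. liminf (\<lambda>n. ennreal (v n s)) \<partial>\<mu>) \<le> liminf (\<lambda>n. \<integral>\<^sup>+ s. ennreal (v n s) \<partial>\<mu>)"
    by (rule nn_integral_liminf) measurable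
  also have "\<dots> \<le> liminf (\<lambda>n. I + ennreal 1)"
  proof (rule Liminf_mono, rule always_eventually, rule allI)
    fix n
    have "I + ennreal (1 / Suc n) \<le> I + ennreal 1"
      by (intro add_left_mono ennreal_leI) simp
    with Iv show "(\<integral>\<^sup>+ s. ennreal (v n s) \<partial>\<mu>) \<le> I + ennreal 1" by (rule order_trans)
  qed
  also have "\<dots> = I + ennreal 1" by (simp add: Liminf_const)
  finally have "(\<integral>\<^sup>+ s. liminf (\<lambda>n. ennreal (v n s)) \<partial>\<mu>) \<noteq> \<infinity>"
    using \<open>I \<noteq> \<infinity>\<close> by (auto simp: top_unique)
  then have "AE s in \<mu>. liminf (\<lambda>n. ennreal (v n s)) \<noteq> \<infinity>"
    by (intro nn_integral_noteq_infinite) measurable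
  moreover have "AE s in \<mu>. \<forall>n. f (eval_path (x n) s) s \<le> ereal (m s + v n s)"
    using fv by (simp add: AE_all_countable)
  ultimately have "AE s in \<mu>. bounded (range (\<lambda>n. \<Sum>t\<in>UNIV. x n t (s t)))"
    using conv AE_space
  proof eventually_elim
    case (elim s)
    have "convergent (\<lambda>n. exp (- v n s / 2))"
      using elim(3) by (simp add: a_def v_def case_prod_beta)
    then obtain c where c: "\<And>n. v n s \<le> c"
      using bounded_above_if_exp_convergent[OF _ elim(1)] by blast
    have le: "f (eval_path (x n) s) s \<le> ereal (m s + c)" for n
      using elim(2) c[of n] by (meson add_left_mono ereal_less_eq(3) order_trans)
    have "range (\<lambda>n. \<Sum>t\<in>UNIV. x n t (s t))
        \<subseteq> (\<lambda>z. \<Sum>t\<in>UNIV. z $ t) ` {z. f z s \<le> ereal (m s + c)}"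
    proof (rule image_subsetI)
      fix n
      show "(\<Sum>t\<in>UNIV. x n t (s t)) \<in> (\<lambda>z. \<Sum>t\<in>UNIV. z $ t) ` {z. f z s \<le> ereal (m s + c)}"
        using le[of n] by (intro image_eqI[of _ _ "eval_path (x n) s"]) (auto simp: eval_path_def)
    qed
    then show ?case
      by (rule bounded_subset[OF bounded_sum_sublevel[OF closed_epi convex_epi recession_space], rotated 3])
         (use elim(4) in auto)
  qed
  moreover have "total (x n) \<le> I + ennreal (1 / Suc n)" for n
    using total_le[OF fv] Iv by (rule order_trans)
  ultimately show thesis using x that by blast
qed

text \<open>If the sums stay bounded at \<open>\<mu>\<close>-almost every, hence at product-almost every point, then there is
  a point \<open>p\<close> such that they stay bounded when almost any value is substituted for one coordinate of \<open>p\<close>.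
  Such a substitution changes the sum by the increment of one component.\<close>

lemma bounded_components_shift:
  fixes x :: "nat \<Rightarrow> 't \<Rightarrow> 'a \<Rightarrow> real^'d"
  assumes "AE s in \<mu>. bounded (range (\<lambda>n. \<Sum>t\<in>UNIV. x n t (s t)))"
  obtains c where "\<And>n. (\<chi> t. c n t) \<in> zero_sum"
    "\<And>t. AE r in \<nu> t. bounded (range (\<lambda>n. x n t r + c n t))"
proof -
  define u where "u n s = (\<Sum>t\<in>UNIV. x n t (s t))" for n s
  have ae: "AE s in PiM UNIV \<nu>. bounded (range (\<lambda>n. u n s))"
    using AE_PiM_if_AE[OF assms] by (simp add: u_def)
  then have "AE s in PiM UNIV \<nu>. \<forall>t. AE r in \<nu> t. bounded (range (\<lambda>n. u n (s(t := r))))"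
    unfolding AE_all_countable by (intro allI nu.AE_PiM_fun_upd) auto
  then have "AE s in PiM UNIV \<nu>. bounded (range (\<lambda>n. u n s))
      \<and> (\<forall>t. AE r in \<nu> t. bounded (range (\<lambda>n. u n (s(t := r)))))"
    using ae by simp
  then obtain p where p: "bounded (range (\<lambda>n. u n p))"
    and upd: "\<And>t. AE r in \<nu> t. bounded (range (\<lambda>n. u n (p(t := r))))"
    using eventually_happens'[OF nu.P.ae_filter_bot] by blast
  obtain t0 :: 't where True by blast
  \<comment> \<open>The component \<open>t0\<close> absorbs the values at \<open>p\<close> of all components.\<close>
  define c where "c n t = (if t = t0 then u n p else 0) - x n t (p t)" for n t
  have "(\<chi> t. c n t) \<in> zero_sum" for n
    by (simp add: zero_sum_def c_def sum_subtractf u_def)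
  moreover have "AE r in \<nu> t. bounded (range (\<lambda>n. x n t r + c n t))" for t
    using upd[of t]
  proof eventually_elim
    case (elim r)
    obtain B where B: "\<And>n. norm (u n (p(t := r))) \<le> B"
      using elim by (auto simp: bounded_iff)
    obtain B' where B': "\<And>n. norm (u n p) \<le> B'"
      using p by (auto simp: bounded_iff)
    have "norm (x n t r + c n t) \<le> B + B'" for n
    proof -
      have "u n (p(t := r)) = x n t r + (\<Sum>t'\<in>UNIV - {t}. x n t' (p t'))"
        unfolding u_def by (subst sum.remove[of _ t]) auto
      moreover have "u n p = x n t (p t) + (\<Sum>t'\<in>UNIV - {t}. x n t' (p t'))"
        unfolding u_def by (subst sum.remove[of _ t]) auto
      ultimately have "x n t r + c n t = (if t = t0 then u n (p(t := r)) else u n (p(t := r)) - u n p)"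
        by (cases "t = t0") (simp_all add: c_def)
      moreover have "0 \<le> B'" using B'[of 0] norm_ge_zero order_trans by blast
      ultimately show ?thesis
        using B[of n] B'[of n] norm_triangle_ineq4[of "u n (p(t := r))" "u n p"] by auto
    qed
    then show ?case by (auto simp: bounded_iff)
  qed
  ultimately show thesis using that by blast
qed

lemma AE_norm_le_real_function:
  fixes y :: "nat \<Rightarrow> 'a \<Rightarrow> real^'d"
  assumes [measurable]: "\<And>n. y n \<in> borel_measurable (\<nu> t)"
    and bd: "AE r in \<nu> t. bounded (range (\<lambda>n. y n r))"
  obtains R :: "'a \<Rightarrow> real" where "R \<in> borel_measurable (\<nu> t)" "AE r in \<nu> t. \<forall>n. norm (y n r) \<le> R r"
proof
  let ?R = "\<lambda>r. enn2real (SUP n. ennreal (norm (y n r)))"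
  show "?R \<in> borel_measurable (\<nu> t)" by measurable
  show "AE r in \<nu> t. \<forall>n. norm (y n r) \<le> ?R r"
    using bd
  proof eventually_elim
    case (elim r)
    then obtain B where B: "\<And>n. norm (y n r) \<le> B" by (auto simp: bounded_iff)
    then have "(SUP n. ennreal (norm (y n r))) \<le> ennreal B"
      by (intro SUP_least ennreal_leI)
    then have "(SUP n. ennreal (norm (y n r))) < top"
      using ennreal_less_top le_less_trans by blast
    then show ?case
      by (intro allI) (metis (no_types, lifting) SUP_upper UNIV_I enn2real_ennreal enn2real_mono norm_ge_zero)
  qed
qed

text \<open>Among the paths that satisfy fixed pointwise bounds \<open>R t\<close>, a minimizing sequence is chosen that
  converges in the Hilbert space with weights \<open>1 / (1 + (R t)\<^sup>2)\<close>.\<close>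

lemma convergent_minimizing_sequence:
  assumes "I \<noteq> \<infinity>"
    and min: "\<And>n. \<exists>x\<in>feasible S \<mu> f. total x \<le> I + ennreal (1 / Suc n)"
  obtains x where "\<And>n. x n \<in> feasible S \<mu> f" "\<And>n. total (x n) \<le> I + ennreal (1 / Suc n)"
    "\<And>t. AE r in \<nu> t. convergent (\<lambda>n. x n t r)"
proof -
  obtain x where x: "\<And>n. x n \<in> feasible S \<mu> f" "\<And>n. total (x n) \<le> I + ennreal (1 / Suc n)"
    and bd: "AE s in \<mu>. bounded (range (\<lambda>n. \<Sum>t\<in>UNIV. x n t (s t)))"
    using bounded_minimizing_sequence[OF assms] by blast
  obtain c where c: "\<And>n. (\<chi> t. c n t) \<in> zero_sum"
    and bdc: "\<And>t. AE r in \<nu> t. bounded (range (\<lambda>n. x n t r + c n t))"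
    using bounded_components_shift[OF bd] by blast
  define y where "y n t r = x n t r + c n t" for n t r
  have y: "y n \<in> feasible S \<mu> f" and toty: "total (y n) \<le> I + ennreal (1 / Suc n)" for n
    using feasible_shift[OF x(1)[of n] c[of n]] total_shift[OF c, of "x n" n] x(2)[of n] by (simp_all add: y_def[abs_def])
  have "\<exists>R :: 'a \<Rightarrow> real. R \<in> borel_measurable (\<nu> t) \<and> (AE r in \<nu> t. \<forall>n. norm (y n t r) \<le> R r)" for t
  proof -
    have "y n t \<in> borel_measurable (\<nu> t)" for n
      using feasible_measurable[OF y] measurable_cong_sets[OF sets_nu refl] by blast
    with bdc[of t] show ?thesis
      using AE_norm_le_real_function[of "\<lambda>n. y n t" t] by (auto simp: y_def)
  qed
  then have "\<exists>R :: 't \<Rightarrow> 'a \<Rightarrow> real. \<forall>t. R t \<in> borel_measurable (\<nu> t)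
      \<and> (AE r in \<nu> t. \<forall>n. norm (y n t r) \<le> R t r)"
    by (intro choice allI)
  then obtain R :: "'t \<Rightarrow> 'a \<Rightarrow> real" where Rm: "\<And>t. R t \<in> borel_measurable (\<nu> t)"
    and R: "\<And>t. AE r in \<nu> t. \<forall>n. norm (y n t r) \<le> R t r"
    by blast
  have Rm' [measurable]: "R t \<in> borel_measurable (borel_of (S t))" for t
    using Rm[of t] measurable_cong_sets[OF sets_nu refl] by blast
  define W where "W t r = sqrt (1 + (R t r)\<^sup>2)" for t r
  have Wm [measurable]: "W t \<in> borel_measurable (borel_of (S t))" for t
    unfolding W_def[abs_def] by measurable
  have W0: "W t r > 0" and RW: "R t r \<le> W t r" for t r
    by (auto simp: W_def add_pos_nonneg intro: real_le_rsqrt)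
  define C where "C n = {z \<in> feasible S \<mu> f. total z \<le> I + ennreal (1 / Suc n)
      \<and> (\<forall>t. AE r in \<nu> t. norm (z t r) \<le> R t r)}" for n
  define a where "a z s = (\<chi> t. z t (s t) /\<^sub>R W t (s t))" for z :: "'t \<Rightarrow> 'a \<Rightarrow> real^'d" and s
  have ne: "C n \<noteq> {}" for n
  proof -
    have "AE r in \<nu> t. norm (y n t r) \<le> R t r" for t
      using R[of t] by eventually_elim simp
    with y toty show ?thesis by (auto simp: C_def)
  qed
  have dec: "decseq C"
  proof (rule decseq_SucI)
    fix n
    have "I + ennreal (1 / Suc (Suc n)) \<le> I + ennreal (1 / Suc n)"
      by (intro add_left_mono ennreal_leI) (simp add: field_simps)
    then show "C (Suc n) \<subseteq> C n"
      unfolding C_def by (blast intro: order_trans)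
  qed
  have mid: "midpath z w \<in> C n" if "z \<in> C n" "w \<in> C n" for z w n
  proof -
    have z: "z \<in> feasible S \<mu> f" "total z \<le> I + ennreal (1 / Suc n)" "\<And>t. AE r in \<nu> t. norm (z t r) \<le> R t r"
      and w: "w \<in> feasible S \<mu> f" "total w \<le> I + ennreal (1 / Suc n)" "\<And>t. AE r in \<nu> t. norm (w t r) \<le> R t r"
      using that by (auto simp: C_def)
    have "AE r in \<nu> t. norm (midpath z w t r) \<le> R t r" for t
      using z(3)[of t] w(3)[of t]
    proof eventually_elim
      case (elim r)
      then show ?case
        using norm_triangle_ineq[of "z t r" "w t r"] by (simp add: midpath_def midpoint_def)
    qed
    moreover have "total (midpath z w) \<le> I + ennreal (1 / Suc n)"
      using total_midpath_le[OF z(1) w(1)] z(2) w(2) by (meson max.bounded_iff order_trans)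
    ultimately show ?thesis
      using feasible_midpath[OF z(1) w(1)] by (simp add: C_def)
  qed
  have meas: "a z \<in> borel_measurable \<mu>" if "z \<in> C 0" for z
  proof -
    have "z \<in> feasible S \<mu> f" using that by (simp add: C_def)
    note [measurable] = feasible_measurable[OF this]
    have "(\<lambda>r. z t r /\<^sub>R W t r) \<in> borel_measurable (borel_of (S t))" for t
      by measurable
    from borel_measurable_eval_path[OF this] show ?thesis
      by (simp add: a_def[abs_def] eval_path_def[abs_def])
  qed
  have bnd: "AE s in \<mu>. norm (a z s) \<le> real CARD('t)" if "z \<in> C 0" for z
  proof -
    have "AE s in \<mu>. \<forall>t. norm (z t (s t)) \<le> R t (s t)"
      by (rule AE_components) (use that in \<open>simp add: C_def\<close>)
    then show ?thesis
    proof eventually_elim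
      case (elim s)
      have "norm (a z s) \<le> (\<Sum>t\<in>UNIV. norm (a z s $ t))"
        unfolding norm_vec_def by (rule L2_set_le_sum) simp
      also have "\<dots> \<le> (\<Sum>t\<in>(UNIV :: 't set). 1)"
      proof (rule sum_mono)
        fix t
        have "norm (z t (s t)) \<le> W t (s t)" using elim RW order_trans by blast
        then show "norm (a z s $ t) \<le> 1"
          using W0[of t "s t"] by (simp add: a_def field_simps)
      qed
      finally show ?case by simp
    qed
  qed
  have para: "(norm (a w s - a z s))\<^sup>2 / 4
      \<le> ((norm (a z s))\<^sup>2 + (norm (a w s))\<^sup>2) / 2 - (norm (a (midpath z w) s))\<^sup>2" for z w s
  proof -
    have "a (midpath z w) s = (1/2) *\<^sub>R (a z s + a w s)"
      by (simp add: a_def midpath_def midpoint_def vec_eq_iff algebra_simps)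
    then show ?thesis
      by (simp add: power2_norm_eq_inner inner_simps inner_commute field_simps)
  qed
  obtain g where g: "\<And>n. g n \<in> C n" and conv: "AE s in \<mu>. convergent (\<lambda>n. a (g n) s)"
    using AE_convergent_midpoint_minimizers[where C = C and mid = midpath and a = a,
        OF finite_measure_axioms ne dec mid meas bnd para] by blast
  have gf: "g n \<in> feasible S \<mu> f" and gt: "total (g n) \<le> I + ennreal (1 / Suc n)" for n
    using g[of n] by (auto simp: C_def)
  have "AE r in \<nu> t. convergent (\<lambda>n. g n t r)" for t
  proof -
    note [measurable] = feasible_measurable[OF gf]
    have "AE s in \<mu>. Cauchy (\<lambda>n. g n t (s t))"
      using conv
    proof eventually_elim
      case (elim s)
      then obtain l where "(\<lambda>n. a (g n) s) \<longlonglongrightarrow> l"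
        unfolding convergent_def by blast
      then have "(\<lambda>n. W t (s t) *\<^sub>R (a (g n) s $ t)) \<longlonglongrightarrow> W t (s t) *\<^sub>R (l $ t)"
        by (intro tendsto_intros)
      then have "convergent (\<lambda>n. W t (s t) *\<^sub>R (a (g n) s $ t))"
        by (rule convergentI)
      moreover have "W t (s t) *\<^sub>R (a (g n) s $ t) = g n t (s t)" for n
        using W0[of t "s t"] by (simp add: a_def)
      ultimately show ?case by (simp add: Cauchy_convergent_iff)
    qed
    then have "AE r in \<nu> t. Cauchy (\<lambda>n. g n t r)"
      unfolding marginal_def by (subst AE_distr_iff[OF measurable_component sets_Collect_Cauchy]) auto
    then show ?thesis by (simp add: Cauchy_convergent_iff)
  qed
  with gf gt that show thesis by blast
qed

section \<open>Lower semicontinuity and existence\<close>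

lemma limit_minimizes:
  assumes x: "\<And>n. x n \<in> feasible S \<mu> f" and tot: "\<And>n. total (x n) \<le> I + ennreal (1 / Suc n)"
    and conv: "\<And>t. AE r in \<nu> t. convergent (\<lambda>n. x n t r)"
  obtains z where "z \<in> feasible S \<mu> f" "total z \<le> I"
proof -
  note [measurable] = feasible_measurable[OF x]
  define z where "z t r = lim (\<lambda>n. x n t r)" for t r
  have zm: "z t \<in> borel_measurable (borel_of (S t))" for t
    unfolding z_def[abs_def] by measurable
  have z: "(\<lambda>n. eval_path (x n) s) \<longlonglongrightarrow> eval_path z s" if "\<And>t. convergent (\<lambda>n. x n t (s t))" for s
    by (rule vec_tendstoI) (use that in \<open>simp add: eval_path_def z_def convergent_LIMSEQ_iff\<close>)
  have "\<exists>P. (\<forall>t. AE r in \<nu> t. P t r) \<and> (\<forall>s\<in>space \<mu>. (\<forall>t. P t (s t)) \<longrightarrow>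
      eval_path (x n) s \<in> closure (edom (\<lambda>z. f z s)))" for n
    by (rule feasibleE[OF x[of n]]) blast
  then have "\<exists>P. \<forall>n. (\<forall>t. AE r in \<nu> t. P n t r) \<and> (\<forall>s\<in>space \<mu>. (\<forall>t. P n t (s t)) \<longrightarrow>
      eval_path (x n) s \<in> closure (edom (\<lambda>z. f z s)))"
    by (intro choice allI)
  then obtain P where P: "\<And>n t. AE r in \<nu> t. P n t r"
    and cl: "\<And>n s. s \<in> space \<mu> \<Longrightarrow> (\<And>t. P n t (s t)) \<Longrightarrow>
      eval_path (x n) s \<in> closure (edom (\<lambda>z. f z s))"
    by blast
  have "z \<in> feasible S \<mu> f"
  proof (rule feasibleI[OF zm])
    show "AE r in \<nu> t. convergent (\<lambda>n. x n t r) \<and> (\<forall>n. P n t r)" for t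
      using conv P by (simp add: AE_all_countable)
    fix s assume s: "s \<in> space \<mu>" and *: "\<And>t. convergent (\<lambda>n. x n t (s t)) \<and> (\<forall>n. P n t (s t))"
    show "eval_path z s \<in> closure (edom (\<lambda>z. f z s))"
    proof (rule closed_sequentially[OF closed_closure])
      show "eval_path (x n) s \<in> closure (edom (\<lambda>z. f z s))" for n using cl[OF s] * by blast
      show "(\<lambda>n. eval_path (x n) s) \<longlonglongrightarrow> eval_path z s" by (rule z) (use * in blast)
    qed
  qed
  moreover have "total z \<le> I"
  proof -
    have "AE s in \<mu>. excess z s \<le> liminf (\<lambda>n. excess (x n) s)"
      using AE_components[OF conv] AE_space
      by eventually_elim (intro excess_liminf z, auto)
    then have "total z \<le> (\<integral>\<^sup>+ s. liminf (\<lambda>n. excess (x n) s) \<partial>\<mu>)"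
      unfolding total_def by (rule nn_integral_mono_AE)
    also have "\<dots> \<le> liminf (\<lambda>n. total (x n))"
      unfolding total_def by (rule nn_integral_liminf[OF borel_measurable_excess[OF x]])
    also have "\<dots> \<le> liminf (\<lambda>n. I + ennreal (1 / Suc n))"
      using tot by (intro Liminf_mono always_eventually) blast
    also have "\<dots> = I + ennreal 0"
    proof (rule lim_imp_Liminf[OF sequentially_bot])
      have "(\<lambda>n. 1 / real (Suc n)) \<longlonglongrightarrow> 0" by (rule LIMSEQ_Suc[OF lim_1_over_n])
      then show "(\<lambda>n. I + ennreal (1 / Suc n)) \<longlonglongrightarrow> I + ennreal 0"
        by (intro tendsto_add tendsto_const tendsto_ennrealI)
    qed
    finally show ?thesis by simp
  qed
  ultimately show thesis using that by blast
qed

lemma ex_minimizer: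
  assumes "feasible S \<mu> f \<noteq> {}"
  shows "\<exists>x \<in> feasible S \<mu> f. \<forall>y \<in> feasible S \<mu> f. objective \<mu> f x \<le> objective \<mu> f y"
proof -
  have "\<exists>x \<in> feasible S \<mu> f. \<forall>y \<in> feasible S \<mu> f. total x \<le> total y"
  proof (cases "\<forall>x \<in> feasible S \<mu> f. total x = \<infinity>")
    case True
    with assms show ?thesis by (auto simp: ex_in_conv)
  next
    case False
    define I where "I = (INF x\<in>feasible S \<mu> f. total x)"
    have le: "I \<le> total x" if "x \<in> feasible S \<mu> f" for x
      unfolding I_def by (rule INF_lower[OF that])
    have "I \<noteq> \<infinity>"
      using False le by (auto simp: top_unique)
    moreover have "\<exists>x\<in>feasible S \<mu> f. total x \<le> I + ennreal (1 / Suc n)" for n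
    proof -
      have "I < I + ennreal (1 / Suc n)"
        using \<open>I \<noteq> \<infinity>\<close> by (simp add: ennreal_add_left_cancel_less[of I 0, simplified])
      then show ?thesis
        unfolding I_def INF_less_iff by (auto intro: less_imp_le)
    qed
    ultimately obtain x where x: "\<And>n. x n \<in> feasible S \<mu> f" "\<And>n. total (x n) \<le> I + ennreal (1 / Suc n)"
      "\<And>t. AE r in \<nu> t. convergent (\<lambda>n. x n t r)"
      using convergent_minimizing_sequence by blast
    obtain z where "z \<in> feasible S \<mu> f" "total z \<le> I"
      using limit_minimizes[OF x] by blast
    with le show ?thesis using order_trans by blast
  qed
  then show ?thesis
    using objective_eq_total by (auto intro!: add_right_mono simp: less_eq_ennreal.rep_eq)
qed

end

theorem theorem15:
  fixes S :: "'t::finite \<Rightarrow> 'a topology"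
    and \<mu> :: "('t \<Rightarrow> 'a) measure"
    and f :: "real^'d^'t \<Rightarrow> ('t \<Rightarrow> 'a) \<Rightarrow> ereal"
  assumes polish: "\<And>t. polish_topology (S t)"
    and prob: "prob_space \<mu>"
    and sets_mu: "sets \<mu> = sets (borel_of (prod_space S))"
    and integrand: "convex_normal_integrand (borel_of (prod_space S)) f"
    and ac: "absolutely_continuous \<mu> (PiM UNIV (marginal S \<mu>))"
    and lower_bound: "\<exists>m::('t \<Rightarrow> 'a) \<Rightarrow> real. integrable \<mu> m \<and>
          (AE s in \<mu>. \<forall>x. ereal (m s) \<le> f x s)"
    and recession: "\<And>s. s \<in> topspace (prod_space S) \<Longrightarrow>
          {x. recession_fun (\<lambda>z. f z s) x \<le> 0} = zero_sum"
    and nonempty: "feasible S \<mu> f \<noteq> {}"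
  shows "\<exists>x \<in> feasible S \<mu> f. \<forall>y \<in> feasible S \<mu> f. objective \<mu> f x \<le> objective \<mu> f y"
proof -
  obtain m :: "('t \<Rightarrow> 'a) \<Rightarrow> real" where "integrable \<mu> m" "AE s in \<mu>. \<forall>x. ereal (m s) \<le> f x s"
    using lower_bound by blast
  then interpret sum_coercive_problem S \<mu> f m
    by (intro sum_coercive_problem.intro prob sets_mu integrand ac recession)
  show ?thesis using nonempty by (rule ex_minimizer)
qed

end
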